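(* Let $\mathbb{F}$ be a field of characteristic $2$ and let $(U,\mu,Q,1)$ be a unital composition algebra in the symmetric tensor category $\mathsf{Ver}_4^+$ over $\mathbb{F}$ with nontrivial Frobenius twist (equivalently, $\ker t\neq\operatorname{im} t$). Then $t=0$ on $U$ and, therefore, $(U,\mu,Q,1)$ is a usual unital composition algebra, i.e., a composition algebra in the category of finite-dimensional vector spaces over $\mathbb{F}$.
   Context: Let $\mathbb{F}$ be a field of characteristic $2$. $\mathsf{Ver}_4^+$ is the symmetric tensor category of finite-dimensional modules over the Hopf algebra $\mathbb{F}[t]=\mathbb{F}1\oplus\mathbb{F}t$, $t^2=0$, with $t$ primitive (so $t(u\otimes v)=t(u)\otimes v+u\otimes t(v)$ on tensor products, and $t$ acts as $0$ on the unit object $\mathbb{F}$), with braiding $c_{U,V}(u\otimes v)=v\otimes u+t(v)\otimes t(u)$. Morphisms are linear maps commuting with $t$. Here $\ker t$ and $\operatorname{im} t$ are the kernel and image of the action of $t$ on $U$. An algebra $(U,\mu)$ in $\mathsf{Ver}_4^+$ is an object with a morphism $\mu:U\otimes U\to U$, $\mu(u\otimes v)=uv$ (not necessarily associative); thus $t$ acts as a derivation. It is unital, written $(U,\mu,1)$, if there is a morphism $\mathbb{F}\to U$ sending the unit of $\mathbb{F}$ to an element $1$ with $1u=u=u1$ for all $u$. Let $\Gamma^2(U)=\ker(\mathrm{id}-c_{U,U})\subseteq U\otimes U$. A quadratic form on $U$ is a morphism $Q:\Gamma^2(U)\to\mathbb{F}$. Its associated bilinear form is $B(u,v)=Q\bigl(u\otimes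 v+v\otimes u+t(v)\otimes t(u)\bigr)$, which is symmetric; $Q$ is nondegenerate if $B$ is nondegenerate. The multiplication $\hat\mu$ on $U\otimes U$ is $(\mu\otimes\mu)\circ(\mathrm{id}\otimes c_{U,U}\otimes\mathrm{id})$, i.e. $(a\otimes b)(c\otimes d)=ac\otimes bd+a\,t(c)\otimes t(b)\,d$; it restricts to a multiplication $\tilde\mu$ on $\Gamma^2(U)$. $Q$ is multiplicative if $Q\circ\tilde\mu=Q\otimes Q$ on $\Gamma^2(U)\otimes\Gamma^2(U)$. A unital composition algebra $(U,\mu,Q,1)$ in $\mathsf{Ver}_4^+$ is a unital algebra with a nondegenerate multiplicative quadratic form $Q$. The Frobenius twist $U^{(1)}$ is the image of the composition $\Gamma^2(U)\hookrightarrow U\otimes U\twoheadrightarrow S^2(U)=\operatorname{coker}(\mathrm{id}-c_{U,U})$; it is known that $U^{(1)}=0$ if and only if $\ker t=\operatorname{im} t$. A (usual) unital composition algebra in vector spaces is a finite-dimensional unital, not necessarily associative, algebra with a quadratic form $Q$ whose polar form $Q(u+v)-Q(u)-Q(v)$ is nondegenerate and such that $Q(uv)=Q(u)Q(v)$; when $t=0$, $\Gamma^2(U)$ is the space of symmetric tensors and $Q:\Gamma^2(U)\to\mathbb{F}$ corresponds to the usual quadratic form $Q(u)=Q(u\otimes u)$. *)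

theory Defs
  imports Complex_Main "HOL-Library.Function_Algebras"
begin

section \<open>Vector spaces with carriers\<close>

text \<open>
  A vector space is a subspace \<open>vcarrier\<close> of an ambient type on which the field acts by
  \<open>vscale\<close>. Carriers are needed for \<open>\<Gamma>\<^sup>2(U)\<close> and for tensor products, which are proper subspaces
  of their ambient types.
\<close>

record ('f, 'a) vs =
  vscale :: "'f \<Rightarrow> 'a \<Rightarrow> 'a"
  vcarrier :: "'a set"

definition vspace :: "('f::field, 'a::ab_group_add, 'z) vs_scheme \<Rightarrow> bool" where
  "vspace X \<longleftrightarrow> vector_space (vscale X) \<and> module.subspace (vscale X) (vcarrier X)"

definition fin_dim :: "('f::field, 'a::ab_group_add, 'z) vs_scheme \<Rightarrow> bool" where
  "fin_dim X \<longleftrightarrow> (\<exists>B. finite B \<and> vcarrier X = module.span (vscale X) B)"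

definition linear_map ::
  "('f::field, 'a::ab_group_add, 'y) vs_scheme \<Rightarrow> ('f, 'b::ab_group_add, 'z) vs_scheme \<Rightarrow> ('a \<Rightarrow> 'b) \<Rightarrow> bool"
  where
  "linear_map X Y f \<longleftrightarrow>
     f ` vcarrier X \<subseteq> vcarrier Y \<and>
     (\<forall>u\<in>vcarrier X. \<forall>v\<in>vcarrier X. f (u + v) = f u + f v) \<and>
     (\<forall>a. \<forall>u\<in>vcarrier X. f (vscale X a u) = vscale Y a (f u))"

definition bilinear_map ::
  "('f::field, 'a::ab_group_add, 'x) vs_scheme \<Rightarrow> ('f, 'b::ab_group_add, 'y) vs_scheme
    \<Rightarrow> ('f, 'c::ab_group_add, 'z) vs_scheme \<Rightarrow> ('a \<Rightarrow> 'b \<Rightarrow> 'c) \<Rightarrow> bool"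
  where
  "bilinear_map X Y Z f \<longleftrightarrow>
     (\<forall>v\<in>vcarrier Y. linear_map X Z (\<lambda>u. f u v)) \<and> (\<forall>u\<in>vcarrier X. linear_map Y Z (f u))"

definition ground_vs :: "('f::field, 'f) vs" where
  "ground_vs = \<lparr>vscale = (*), vcarrier = UNIV\<rparr>"

section \<open>Tensor products of vector spaces\<close>

text \<open>
  The pure tensor of \<open>u\<close> and \<open>v\<close> is the functional "evaluate at \<open>(u, v)\<close>" on bilinear forms, and
  the tensor product is the span of the pure tensors. Over a field, bilinear forms separate the
  elements of the tensor product, so this is the tensor product also in infinite dimension. The
  universal property is lemmas \<open>bilinear_tens\<close>, \<open>lift_linear\<close>, \<open>lift_tens\<close> and \<open>lift_unique\<close> below.
\<close>

type_synonym ('f, 'a, 'b) tens = "('a \<Rightarrow> 'b \<Rightarrow> 'f) \<Rightarrow> 'f"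

definition tens ::
  "('f::field, 'a::ab_group_add, 'y) vs_scheme \<Rightarrow> ('f, 'b::ab_group_add, 'z) vs_scheme
    \<Rightarrow> 'a \<Rightarrow> 'b \<Rightarrow> ('f, 'a, 'b) tens"
  where
  "tens X Y u v = (\<lambda>\<beta>. if bilinear_map X Y ground_vs \<beta> then \<beta> u v else 0)"

definition tens_scale :: "'f::field \<Rightarrow> ('f, 'a, 'b) tens \<Rightarrow> ('f, 'a, 'b) tens" where
  "tens_scale a x = (\<lambda>\<beta>. a * x \<beta>)"

definition tensor_vs ::
  "('f::field, 'a::ab_group_add, 'y) vs_scheme \<Rightarrow> ('f, 'b::ab_group_add, 'z) vs_scheme
    \<Rightarrow> ('f, ('f, 'a, 'b) tens) vs"
  where
  "tensor_vs X Y =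
     \<lparr>vscale = tens_scale,
      vcarrier = module.span tens_scale {tens X Y u v | u v. u \<in> vcarrier X \<and> v \<in> vcarrier Y}\<rparr>"

text \<open>
  \<open>lift X Y Z f\<close> is the linear map on the tensor product sending \<open>u \<otimes> v\<close> to \<open>f u v\<close>; its values
  outside the carrier of the tensor product are irrelevant.
\<close>

definition lift ::
  "('f::field, 'a::ab_group_add, 'x) vs_scheme \<Rightarrow> ('f, 'b::ab_group_add, 'y) vs_scheme
    \<Rightarrow> ('f, 'c::ab_group_add, 'z) vs_scheme \<Rightarrow> ('a \<Rightarrow> 'b \<Rightarrow> 'c) \<Rightarrow> ('f, 'a, 'b) tens \<Rightarrow> 'c"
  where
  "lift X Y Z f =
     (SOME g. linear_map (tensor_vs X Y) Z g \<and>
        (\<forall>u\<in>vcarrier X. \<forall>v\<in>vcarrier Y. g (tens X Y u v) = f u v))"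

lemma vector_space_tens_scale: "vector_space (tens_scale :: 'f::field \<Rightarrow> ('f, 'a, 'b) tens \<Rightarrow> _)"
  by unfold_locales (auto simp: tens_scale_def fun_eq_iff algebra_simps)

lemma tens_in_tensor:
  fixes X :: "('f::field, 'a::ab_group_add, 'x) vs_scheme"
    and Y :: "('f, 'b::ab_group_add, 'y) vs_scheme"
  assumes "u \<in> vcarrier X" "v \<in> vcarrier Y"
  shows "tens X Y u v \<in> vcarrier (tensor_vs X Y)"
proof -
  interpret T: vector_space "tens_scale :: 'f \<Rightarrow> ('f, 'a, 'b) tens \<Rightarrow> _"
    by (rule vector_space_tens_scale)
  show ?thesis using assms by (auto simp: tensor_vs_def intro!: T.span_base)
qed

lemma bilinear_tens: "bilinear_map X Y (tensor_vs X Y) (tens X Y)"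
  by (auto simp: bilinear_map_def linear_map_def ground_vs_def tens_in_tensor)
     (auto simp: tens_def tensor_vs_def tens_scale_def fun_eq_iff bilinear_map_def linear_map_def ground_vs_def)

lemma lift_exists:
  fixes X :: "('f::field, 'a::ab_group_add, 'x) vs_scheme"
    and Y :: "('f, 'b::ab_group_add, 'y) vs_scheme"
    and Z :: "('f, 'c::ab_group_add, 'z) vs_scheme"
  assumes Z: "vspace Z" and f: "bilinear_map X Y Z f"
  shows "\<exists>g. linear_map (tensor_vs X Y) Z g \<and>
        (\<forall>u\<in>vcarrier X. \<forall>v\<in>vcarrier Y. g (tens X Y u v) = f u v)"
proof -
  interpret T: vector_space "tens_scale :: 'f \<Rightarrow> ('f, 'a, 'b) tens \<Rightarrow> _"
    by (rule vector_space_tens_scale)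
  interpret Z: vector_space "vscale Z" using Z by (simp add: vspace_def)
  interpret F: vector_space "(*) :: 'f \<Rightarrow> 'f \<Rightarrow> 'f" by unfold_locales (auto simp: algebra_simps)
  interpret TZ: vector_space_pair "tens_scale :: 'f \<Rightarrow> ('f, 'a, 'b) tens \<Rightarrow> _" "vscale Z" ..
  interpret ZF: vector_space_pair "vscale Z" "(*) :: 'f \<Rightarrow> 'f \<Rightarrow> 'f" ..
  have subZ: "Z.subspace (vcarrier Z)" using Z by (simp add: vspace_def)
  define P where "P = {tens X Y u v | u v. u \<in> vcarrier X \<and> v \<in> vcarrier Y}"
  obtain A where A: "A \<subseteq> P" "T.independent A" "P \<subseteq> T.span A"
    using T.maximal_independent_subset[of P] by blast
  have spanA: "T.span A = T.span P"
    using A by (metis T.span_mono T.span_span subset_antisym)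
  have "\<forall>p\<in>P. \<exists>u v. p = tens X Y u v \<and> u \<in> vcarrier X \<and> v \<in> vcarrier Y"
    unfolding P_def by blast
  then obtain U V where UV: "\<And>p. p \<in> P \<Longrightarrow> p = tens X Y (U p) (V p)"
      "\<And>p. p \<in> P \<Longrightarrow> U p \<in> vcarrier X" "\<And>p. p \<in> P \<Longrightarrow> V p \<in> vcarrier Y"
    by metis
  obtain g where g: "Vector_Spaces.linear tens_scale (vscale Z) g"
      "\<And>p. p \<in> A \<Longrightarrow> g p = f (U p) (V p)"
    using TZ.linear_independent_extend[OF A(2), of "\<lambda>p. f (U p) (V p)"] by blast
  interpret g: Vector_Spaces.linear "tens_scale :: 'f \<Rightarrow> ('f, 'a, 'b) tens \<Rightarrow> _" "vscale Z" g
    by (rule g(1))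
  have fZ: "f u v \<in> vcarrier Z" if "u \<in> vcarrier X" "v \<in> vcarrier Y" for u v
    using f that unfolding bilinear_map_def linear_map_def by blast
  have gA: "g ` A \<subseteq> vcarrier Z" using g(2) UV fZ A(1) by auto
  have "g ` T.span A = Z.span (g ` A)" by (simp add: g.span_image)
  also have "\<dots> \<subseteq> vcarrier Z" using gA subZ by (rule Z.span_minimal)
  finally have "g ` vcarrier (tensor_vs X Y) \<subseteq> vcarrier Z"
    by (simp add: tensor_vs_def spanA P_def)
  then have lin: "linear_map (tensor_vs X Y) Z g"
    by (simp add: linear_map_def g.add g.scale tensor_vs_def)
  have "g (tens X Y u v) = f u v" if uv: "u \<in> vcarrier X" "v \<in> vcarrier Y" for u v
  proof (rule ccontr)
    define z where "z = g (tens X Y u v) - f u v"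
    assume "g (tens X Y u v) \<noteq> f u v"
    then have "Z.independent {z}" by (simp add: z_def)
    from ZF.linear_independent_extend[OF this, of "\<lambda>_. 1"]
    obtain h where h: "Vector_Spaces.linear (vscale Z) (*) h" "h z = 1" by blast
    interpret h: Vector_Spaces.linear "vscale Z" "(*)" h by (rule h(1))
    have hf: "bilinear_map X Y ground_vs (\<lambda>u v. h (f u v))"
      using f by (auto simp: bilinear_map_def linear_map_def ground_vs_def h.add h.scale)
    have "h (g x) = x (\<lambda>u v. h (f u v))" if "x \<in> T.span A" for x
      using that
    proof (induction rule: T.span_induct_alt)
      case base
      show ?case by (metis g.zero h.zero zero_fun_apply)
    next
      case (step c a y)
      have a: "a \<in> P" using step A by auto
      have "a (\<lambda>u v. h (f u v)) = tens X Y (U a) (V a) (\<lambda>u v. h (f u v))"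
        using UV(1)[OF a] by simp
      also have "\<dots> = h (f (U a) (V a))" using hf by (simp add: tens_def)
      finally have "h (g (tens_scale c a) + g y) = (tens_scale c a + y) (\<lambda>u v. h (f u v))"
        using step g(2)[of a] by (simp add: h.add g.scale h.scale) (simp add: tens_scale_def)
      then show ?case by (metis g.add)
    qed
    moreover have "tens X Y u v \<in> T.span A" using uv A(3) unfolding P_def by blast
    ultimately have "h (g (tens X Y u v)) = h (f u v)" using hf by (simp add: tens_def)
    then show False using h(2) by (simp add: z_def h.diff)
  qed
  with lin show ?thesis by blast
qed

lemma
  assumes "vspace Z" "bilinear_map X Y Z f"
  shows lift_linear: "linear_map (tensor_vs X Y) Z (lift X Y Z f)"
    and lift_tens: "u \<in> vcarrier X \<Longrightarrow> v \<in> vcarrier Y \<Longrightarrow> lift X Y Z f (tens X Y u v) = f u v"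
  using someI_ex[OF lift_exists[OF assms]] unfolding lift_def by blast+

lemma lift_unique:
  fixes X :: "('f::field, 'a::ab_group_add, 'x) vs_scheme"
    and Y :: "('f, 'b::ab_group_add, 'y) vs_scheme"
    and Z :: "('f, 'c::ab_group_add, 'z) vs_scheme"
  assumes "vspace Z"
    and g: "linear_map (tensor_vs X Y) Z g" and h: "linear_map (tensor_vs X Y) Z h"
    and eq: "\<And>u v. u \<in> vcarrier X \<Longrightarrow> v \<in> vcarrier Y \<Longrightarrow> g (tens X Y u v) = h (tens X Y u v)"
    and x: "x \<in> vcarrier (tensor_vs X Y)"
  shows "g x = h x"
proof -
  interpret T: vector_space "tens_scale :: 'f \<Rightarrow> ('f, 'a, 'b) tens \<Rightarrow> _"
    by (rule vector_space_tens_scale)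
  define P where "P = {tens X Y u v | u v. u \<in> vcarrier X \<and> v \<in> vcarrier Y}"
  have add: "k (x + y) = k x + k y"
    and scale: "k (tens_scale c x) = vscale Z c (k x)"
    if "linear_map (tensor_vs X Y) Z k" "x \<in> T.span P" "y \<in> T.span P" for k x y c
    using that by (auto simp: linear_map_def tensor_vs_def P_def)
  have zero: "k 0 = 0" if "linear_map (tensor_vs X Y) Z k" for k
    using add[OF that, of 0 0] by (simp add: T.span_zero)
  have "x \<in> T.span P" using x by (simp add: tensor_vs_def P_def)
  then have "x \<in> T.span P \<and> g x = h x"
  proof (induction rule: T.span_induct_alt)
    case base
    show ?case using T.span_zero zero[OF g] zero[OF h] by metis
  next
    case (step c a y)
    have a: "a \<in> T.span P" using step by (simp add: T.span_base)
    have "g a = h a" using step eq unfolding P_def by auto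
    then have "g (tens_scale c a + y) = h (tens_scale c a + y)"
      using step a add[OF g T.span_scale[OF a, of c], of y] add[OF h T.span_scale[OF a, of c], of y]
        scale[OF g a a] scale[OF h a a] by metis
    then show ?case using step a by (metis T.span_add T.span_scale)
  qed
  then show ?thesis by simp
qed

section \<open>The category \<open>Ver\<^sub>4\<^sup>+\<close>\<close>

record ('f, 'a) ver4 = "('f, 'a) vs" +
  tact :: "'a \<Rightarrow> 'a"

definition ver4_object :: "('f::field, 'a::ab_group_add) ver4 \<Rightarrow> bool" where
  "ver4_object X \<longleftrightarrow>
     vspace X \<and> fin_dim X \<and> linear_map X X (tact X) \<and> (\<forall>u\<in>vcarrier X. tact X (tact X u) = 0)"

definition ver4_hom ::
  "('f::field, 'a::ab_group_add) ver4 \<Rightarrow> ('f, 'b::ab_group_add) ver4 \<Rightarrow> ('a \<Rightarrow> 'b) \<Rightarrow> bool"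
  where
  "ver4_hom X Y f \<longleftrightarrow> linear_map X Y f \<and> (\<forall>u\<in>vcarrier X. f (tact X u) = tact Y (f u))"

definition unit_object :: "('f::field, 'f) ver4" where
  "unit_object = vs.extend ground_vs (ver4.fields (\<lambda>_. 0))"

definition tensor ::
  "('f::field, 'a::ab_group_add) ver4 \<Rightarrow> ('f, 'b::ab_group_add) ver4 \<Rightarrow> ('f, ('f, 'a, 'b) tens) ver4"
  where
  "tensor X Y = vs.extend (tensor_vs X Y) (ver4.fields
     (lift X Y (tensor_vs X Y) (\<lambda>u v. tens X Y (tact X u) v + tens X Y u (tact Y v))))"

definition braiding ::
  "('f::field, 'a::ab_group_add) ver4 \<Rightarrow> ('f, 'b::ab_group_add) ver4
    \<Rightarrow> ('f, 'a, 'b) tens \<Rightarrow> ('f, 'b, 'a) tens"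
  where
  "braiding X Y =
     lift X Y (tensor Y X) (\<lambda>u v. tens Y X v u + tens Y X (tact Y v) (tact X u))"

definition gamma2 :: "('f::field, 'a::ab_group_add) ver4 \<Rightarrow> ('f, ('f, 'a, 'a) tens) ver4" where
  "gamma2 U = (tensor U U)
     \<lparr>vcarrier := {x \<in> vcarrier (tensor U U). x - braiding U U x = 0}\<rparr>"

text \<open>
  \<open>S\<^sup>2(U)\<close> is represented by the cosets of the image of \<open>id - c\<close>, so its zero is
  \<open>sym2_proj U 0\<close>.
\<close>

definition sym2_proj ::
  "('f::field, 'a::ab_group_add) ver4 \<Rightarrow> ('f, 'a, 'a) tens \<Rightarrow> ('f, 'a, 'a) tens set"
  where
  "sym2_proj U x = {x + (y - braiding U U y) | y. y \<in> vcarrier (tensor U U)}"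

definition frobenius_twist :: "('f::field, 'a::ab_group_add) ver4 \<Rightarrow> ('f, 'a, 'a) tens set set" where
  "frobenius_twist U = sym2_proj U ` vcarrier (gamma2 U)"

section \<open>Composition algebras in \<open>Ver\<^sub>4\<^sup>+\<close>\<close>

definition unital_algebra ::
  "('f::field, 'a::ab_group_add) ver4 \<Rightarrow> (('f, 'a, 'a) tens \<Rightarrow> 'a) \<Rightarrow> 'a \<Rightarrow> bool"
  where
  "unital_algebra U \<mu> e \<longleftrightarrow>
     ver4_object U \<and> ver4_hom (tensor U U) U \<mu> \<and>
     (\<exists>\<eta>. ver4_hom unit_object U \<eta> \<and> \<eta> 1 = e) \<and>
     (\<forall>u\<in>vcarrier U. \<mu> (tens U U e u) = u \<and> \<mu> (tens U U u e) = u)"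

definition quadratic_form ::
  "('f::field, 'a::ab_group_add) ver4 \<Rightarrow> (('f, 'a, 'a) tens \<Rightarrow> 'f) \<Rightarrow> bool"
  where
  "quadratic_form U Q \<longleftrightarrow> ver4_hom (gamma2 U) unit_object Q"

definition assoc_bilinear ::
  "('f::field, 'a::ab_group_add) ver4 \<Rightarrow> (('f, 'a, 'a) tens \<Rightarrow> 'f) \<Rightarrow> 'a \<Rightarrow> 'a \<Rightarrow> 'f"
  where
  "assoc_bilinear U Q u v =
     Q (tens U U u v + tens U U v u + tens U U (tact U v) (tact U u))"

text \<open>Used for symmetric \<open>B\<close> only, so one radical suffices.\<close>

definition nondegenerate :: "'a::zero set \<Rightarrow> ('a \<Rightarrow> 'a \<Rightarrow> 'f::zero) \<Rightarrow> bool" where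
  "nondegenerate V B \<longleftrightarrow> (\<forall>u\<in>V. (\<forall>v\<in>V. B u v = 0) \<longrightarrow> u = 0)"

text \<open>
  \<open>tensor_mult U \<mu>\<close> is the bilinear multiplication on \<open>U \<otimes> U\<close> with
  \<open>(a \<otimes> b)(c \<otimes> d) = ac \<otimes> bd + a t(c) \<otimes> t(b) d\<close>, that is
  \<open>(\<mu> \<otimes> \<mu>) \<circ> (id \<otimes> c \<otimes> id)\<close>.
\<close>

definition tensor_mult ::
  "('f::field, 'a::ab_group_add) ver4 \<Rightarrow> (('f, 'a, 'a) tens \<Rightarrow> 'a)
    \<Rightarrow> ('f, 'a, 'a) tens \<Rightarrow> ('f, 'a, 'a) tens \<Rightarrow> ('f, 'a, 'a) tens"
  where
  "tensor_mult U \<mu> x y =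
     lift U U (tensor U U) (\<lambda>a b.
       lift U U (tensor U U) (\<lambda>c d.
         tens U U (\<mu> (tens U U a c)) (\<mu> (tens U U b d)) +
         tens U U (\<mu> (tens U U a (tact U c))) (\<mu> (tens U U (tact U b) d))) y) x"

definition gamma2_mult ::
  "('f::field, 'a::ab_group_add) ver4 \<Rightarrow> (('f, 'a, 'a) tens \<Rightarrow> 'a)
    \<Rightarrow> ('f, ('f, 'a, 'a) tens, ('f, 'a, 'a) tens) tens \<Rightarrow> ('f, 'a, 'a) tens"
  where
  "gamma2_mult U \<mu> = lift (gamma2 U) (gamma2 U) (tensor U U) (tensor_mult U \<mu>)"

text \<open>The right-hand side below is \<open>Q \<otimes> Q\<close>, with \<open>F \<otimes> F\<close> identified with \<open>F\<close>.\<close>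

definition multiplicative ::
  "('f::field, 'a::ab_group_add) ver4 \<Rightarrow> (('f, 'a, 'a) tens \<Rightarrow> 'a) \<Rightarrow> (('f, 'a, 'a) tens \<Rightarrow> 'f) \<Rightarrow> bool"
  where
  "multiplicative U \<mu> Q \<longleftrightarrow>
     (\<forall>z\<in>vcarrier (tensor (gamma2 U) (gamma2 U)).
        Q (gamma2_mult U \<mu> z) = lift (gamma2 U) (gamma2 U) unit_object (\<lambda>x y. Q x * Q y) z)"

definition unital_composition_algebra ::
  "('f::field, 'a::ab_group_add) ver4 \<Rightarrow> (('f, 'a, 'a) tens \<Rightarrow> 'a) \<Rightarrow> (('f, 'a, 'a) tens \<Rightarrow> 'f)
    \<Rightarrow> 'a \<Rightarrow> bool"
  where
  "unital_composition_algebra U \<mu> Q e \<longleftrightarrow>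
     unital_algebra U \<mu> e \<and> quadratic_form U Q \<and>
     nondegenerate (vcarrier U) (assoc_bilinear U Q) \<and> multiplicative U \<mu> Q"

section \<open>Composition algebras in vector spaces\<close>

definition usual_quadratic_form ::
  "('f::field, 'a::ab_group_add, 'z) vs_scheme \<Rightarrow> ('a \<Rightarrow> 'f) \<Rightarrow> bool"
  where
  "usual_quadratic_form V q \<longleftrightarrow>
     (\<forall>a. \<forall>u\<in>vcarrier V. q (vscale V a u) = a\<^sup>2 * q u) \<and>
     bilinear_map V V ground_vs (\<lambda>u v. q (u + v) - q u - q v)"

definition usual_unital_composition_algebra ::
  "('f::field, 'a::ab_group_add, 'z) vs_scheme \<Rightarrow> ('a \<Rightarrow> 'a \<Rightarrow> 'a) \<Rightarrow> ('a \<Rightarrow> 'f) \<Rightarrow> 'a \<Rightarrow> bool"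
  where
  "usual_unital_composition_algebra V m q e \<longleftrightarrow>
     vspace V \<and> fin_dim V \<and> bilinear_map V V V m \<and>
     e \<in> vcarrier V \<and> (\<forall>u\<in>vcarrier V. m e u = u \<and> m u e = u) \<and>
     usual_quadratic_form V q \<and>
     nondegenerate (vcarrier V) (\<lambda>u v. q (u + v) - q u - q v) \<and>
     (\<forall>u\<in>vcarrier V. \<forall>v\<in>vcarrier V. q (m u v) = q u * q v)"

end

theory Submission
  imports Defs
begin

text \<open>
  Write \<open>T u = B(u, 1)\<close>. Multiplicativity of \<open>Q\<close> on the tensors
  \<open>a \<otimes> b + b \<otimes> a + t(b) \<otimes> t(a)\<close> determines the adjoint of a left multiplication,
  \<open>L\<^sub>u\<^sup>* = T(u) + L\<^sub>u + L\<^bsub>t(u)\<^esub> t\<close>, and yields the twisted Clifford relation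
  \<open>L\<^sub>u L\<^sub>v + L\<^sub>v L\<^sub>u = T(u) L\<^sub>v + T(v) L\<^sub>u + L\<^bsub>t(v)\<^esub> L\<^bsub>t(u)\<^esub> + B(u, v)\<close>.

  If \<open>1 = t(h)\<close>, then \<open>1 \<otimes> 1 = h \<otimes> h - c(h \<otimes> h)\<close>, so \<open>\<Gamma>\<^sup>2(U)\<close> is the image of \<open>id - c\<close> and the
  Frobenius twist vanishes. Hence \<open>1 \<notin> im t\<close>, which forces the \<open>L\<^sub>r\<close> with \<open>r \<in> im t\<close> to square to
  zero; they also commute, so if \<open>t \<noteq> 0\<close> some nonzero \<open>r \<in> im t\<close> is annihilated by \<open>im t\<close>.
  For \<open>B(r, b) = 1\<close> the element \<open>p = rb\<close> is an idempotent of \<open>ker t\<close> with \<open>pr = r\<close> and \<open>rp = 0\<close>.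
  Choose \<open>x\<close> with \<open>t(x) = r\<close> in the Peirce component of \<open>r\<close> and \<open>y\<close> with \<open>B(r, y) = 1\<close> in the opposite
  one. By the Clifford relation \<open>y(xx) = r\<close>, so \<open>w = xx\<close> is nonzero, and \<open>k = xr\<close> satisfies \<open>kw = 0\<close>, so \<open>k\<close> is
  a multiple of \<open>w\<close> and \<open>yk\<close> is a multiple of \<open>r\<close>. But \<open>yk = x + B(x, y) r\<close>, so \<open>x\<close> is a multiple of \<open>r\<close>
  and \<open>r = t(x) = 0\<close>.
\<close>

section \<open>Twisted composition algebras\<close>

text \<open>The axioms with all tensors eliminated. \<open>B_mult\<close> is multiplicativity of
  \<open>Q\<close> on two tensors of the form \<open>(id + \<sigma>)(u \<otimes> v)\<close>;
  \<open>q u\<close> stands for \<open>Q (u \<otimes> u)\<close>, which is meaningful only on the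
  kernel of \<open>t\<close>, hence the guards \<open>t u = 0\<close>. Nontriviality of the
  Frobenius twist enters through \<open>unit_notin_image\<close> alone.\<close>

locale composition_data = vector_space scale
  for scale :: "'f::field \<Rightarrow> 'a::ab_group_add \<Rightarrow> 'a" (infixr "*s" 75) +
  fixes V :: "'a set"
    and m :: "'a \<Rightarrow> 'a \<Rightarrow> 'a" (infixl "\<cdot>" 77)
    and t :: "'a \<Rightarrow> 'a"
    and B :: "'a \<Rightarrow> 'a \<Rightarrow> 'f"
    and q :: "'a \<Rightarrow> 'f"
    and e :: 'a
  assumes two: "(2::'f) = 0"
    and subspace_V: "subspace V"
    and finite_dim: "\<exists>S. finite S \<and> V \<subseteq> span S"
    and m_closed [simp]: "u \<in> V \<Longrightarrow> v \<in> V \<Longrightarrow> u \<cdot> v \<in> V"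
    and m_add_left [simp]: "u \<in> V \<Longrightarrow> v \<in> V \<Longrightarrow> w \<in> V \<Longrightarrow> (u + v) \<cdot> w = u \<cdot> w + v \<cdot> w"
    and m_add_right [simp]: "u \<in> V \<Longrightarrow> v \<in> V \<Longrightarrow> w \<in> V \<Longrightarrow> w \<cdot> (u + v) = w \<cdot> u + w \<cdot> v"
    and m_scale_left [simp]: "u \<in> V \<Longrightarrow> v \<in> V \<Longrightarrow> (a *s u) \<cdot> v = a *s (u \<cdot> v)"
    and m_scale_right [simp]: "u \<in> V \<Longrightarrow> v \<in> V \<Longrightarrow> u \<cdot> (a *s v) = a *s (u \<cdot> v)"
    and e_closed [simp]: "e \<in> V"
    and e_left [simp]: "u \<in> V \<Longrightarrow> e \<cdot> u = u"
    and e_right [simp]: "u \<in> V \<Longrightarrow> u \<cdot> e = u"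
    and t_closed [simp]: "u \<in> V \<Longrightarrow> t u \<in> V"
    and t_add [simp]: "u \<in> V \<Longrightarrow> v \<in> V \<Longrightarrow> t (u + v) = t u + t v"
    and t_scale [simp]: "u \<in> V \<Longrightarrow> t (a *s u) = a *s t u"
    and t_t [simp]: "u \<in> V \<Longrightarrow> t (t u) = 0"
    and t_mult [simp]: "u \<in> V \<Longrightarrow> v \<in> V \<Longrightarrow> t (u \<cdot> v) = t u \<cdot> v + u \<cdot> t v"
    and t_e [simp]: "t e = 0"
    and B_add_left [simp]: "u \<in> V \<Longrightarrow> v \<in> V \<Longrightarrow> w \<in> V \<Longrightarrow> B (u + v) w = B u w + B v w"
    and B_scale_left [simp]: "u \<in> V \<Longrightarrow> v \<in> V \<Longrightarrow> B (a *s u) v = a * B u v"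
    and B_sym: "u \<in> V \<Longrightarrow> v \<in> V \<Longrightarrow> B u v = B v u"
    and B_nondeg: "u \<in> V \<Longrightarrow> (\<And>v. v \<in> V \<Longrightarrow> B u v = 0) \<Longrightarrow> u = 0"
    and B_t: "u \<in> V \<Longrightarrow> v \<in> V \<Longrightarrow> B (t u) v = B u (t v)"
    and B_mult_left: "u \<in> V \<Longrightarrow> v \<in> V \<Longrightarrow> w \<in> V \<Longrightarrow> t u = 0 \<Longrightarrow> B (u \<cdot> v) (u \<cdot> w) = q u * B v w"
    and B_mult_right: "u \<in> V \<Longrightarrow> v \<in> V \<Longrightarrow> w \<in> V \<Longrightarrow> t u = 0 \<Longrightarrow> B (v \<cdot> u) (w \<cdot> u) = q u * B v w"
    and B_mult: "u \<in> V \<Longrightarrow> v \<in> V \<Longrightarrow> w \<in> V \<Longrightarrow> z \<in> V \<Longrightarrow>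
      B u v * B w z = B (u \<cdot> w) (v \<cdot> z) + B (u \<cdot> t w) (t v \<cdot> z) + B (u \<cdot> z) (v \<cdot> w)
        + B (u \<cdot> t z) (t v \<cdot> w) + B (u \<cdot> t z) (v \<cdot> t w)"
    and unit_notin_image: "h \<in> V \<Longrightarrow> t h \<noteq> e"
begin

section \<open>Linear algebra in characteristic 2\<close>

lemma V_zero [simp]: "0 \<in> V"
  and V_add [simp]: "u \<in> V \<Longrightarrow> v \<in> V \<Longrightarrow> u + v \<in> V"
  and V_scale [simp]: "u \<in> V \<Longrightarrow> a *s u \<in> V"
  using subspace_V by (auto simp: subspace_0 subspace_add subspace_scale)

lemma double [simp]: "(x::'a) + x = 0"
proof -
  have "x + x = (1 + 1) *s x" by (simp only: scale_left_distrib scale_one)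
  then show ?thesis by (simp add: two)
qed

lemma double_left [simp]: "(x::'a) + (x + y) = y"
  by (simp flip: add.assoc)

lemma double_field [simp]: "(a::'f) + a = 0"
proof -
  have "a + a = (1 + 1) * a" by (simp only: distrib_right mult_1)
  then show ?thesis by (simp add: two)
qed

lemma double_field_left [simp]: "(a::'f) + (a + b) = b"
  by (simp flip: add.assoc)

lemma sum_zeroD: "(x::'a) + y = 0 \<Longrightarrow> x = y"
  by (metis double_left add.right_neutral)

lemma sum_zeroD_field: "(a::'f) + b = 0 \<Longrightarrow> a = b"
  by (metis double_field_left add.right_neutral)

lemma B_add_right [simp]: "u \<in> V \<Longrightarrow> v \<in> V \<Longrightarrow> w \<in> V \<Longrightarrow> B w (u + v) = B w u + B w v"
  using B_add_left B_sym by simp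

lemma B_scale_right [simp]: "u \<in> V \<Longrightarrow> v \<in> V \<Longrightarrow> B u (a *s v) = a * B u v"
  using B_scale_left B_sym by simp

lemma t_0 [simp]: "t 0 = 0"
  using t_add[of 0 0] by simp

lemma m_0_left [simp]: "u \<in> V \<Longrightarrow> 0 \<cdot> u = 0"
  using m_add_left[of 0 0 u] by simp

lemma m_0_right [simp]: "u \<in> V \<Longrightarrow> u \<cdot> 0 = 0"
  using m_add_right[of 0 0 u] by simp

lemma B_0_left [simp]: "u \<in> V \<Longrightarrow> B 0 u = 0"
  using B_add_left[of 0 0 u] by simp

lemma B_0_right [simp]: "u \<in> V \<Longrightarrow> B u 0 = 0"
  using B_add_right[of 0 0 u] by simp

lemma B_t_t [simp]: "u \<in> V \<Longrightarrow> v \<in> V \<Longrightarrow> B (t u) (t v) = 0"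
  by (simp add: B_t)

lemma eq_zeroI:
  assumes "u \<in> V" "\<And>c. c \<in> V \<Longrightarrow> B c u = 0"
  shows "u = 0"
  using B_nondeg assms B_sym by metis

lemma ex_B_eq_1:
  assumes "u \<in> V" "u \<noteq> 0"
  obtains v where "v \<in> V" "B v u = 1"
proof -
  obtain v where v: "v \<in> V" "B v u \<noteq> 0" using eq_zeroI assms by blast
  then have "B ((1 / B v u) *s v) u = 1" using assms by simp
  then show thesis using that v by (metis V_scale)
qed

section \<open>Trace, adjoints of multiplications and Clifford relations\<close>

abbreviation T :: "'a \<Rightarrow> 'f" where "T u \<equiv> B u e"

lemma T_t [simp]: "u \<in> V \<Longrightarrow> T (t u) = 0"
  by (simp add: B_t)

text \<open>Take \<open>e\<close> as second argument of \<open>B_mult\<close>: the terms with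
  \<open>t e\<close> vanish, and \<open>B_t\<close> moves the remaining outer
  \<open>t\<close>.\<close>

lemma adjoint_left:
  assumes "a \<in> V" "c \<in> V" "d \<in> V"
  shows "B (a \<cdot> c) d = B c (T a *s d + a \<cdot> d + t a \<cdot> t d)"
proof -
  have "B (a \<cdot> t d) (t c) = B c (t a \<cdot> t d)"
    using assms B_t[of "a \<cdot> t d" c] B_sym[of c "t a \<cdot> t d"] by simp
  moreover have "T a * B c d + B (a \<cdot> c) d + B (a \<cdot> d) c + B (a \<cdot> t d) (t c) = 0"
    using B_mult[of a e c d] assms by (simp add: ac_simps)
  ultimately have "B (a \<cdot> c) d + B c (T a *s d + a \<cdot> d + t a \<cdot> t d) = 0" using assms
    by (simp add: ac_simps B_sym[of c "a \<cdot> d"])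
  then show ?thesis by (rule sum_zeroD_field)
qed

text \<open>The mirror image of \<open>adjoint_left\<close>, with \<open>e\<close> as last argument
  of \<open>B_mult\<close>.\<close>

lemma adjoint_right:
  assumes "a \<in> V" "b \<in> V" "c \<in> V"
  shows "B (a \<cdot> c) b = B a (T c *s b + b \<cdot> c + t b \<cdot> t c)"
proof -
  have "B (a \<cdot> t c) (t b) = B (t a \<cdot> t c) b"
    using assms B_t[of "a \<cdot> t c" b] by simp
  moreover have "T c * B b a + B (b \<cdot> c) a + B (b \<cdot> t c) (t a) + B b (a \<cdot> c) = 0"
    using B_mult[of b a c e] assms by (simp add: ac_simps)
  moreover have "B (b \<cdot> t c) (t a) = B a (t b \<cdot> t c)"
    using assms B_t[of "b \<cdot> t c" a] B_sym[of a "t b \<cdot> t c"] by simp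
  ultimately have "B (a \<cdot> c) b + B a (T c *s b + b \<cdot> c + t b \<cdot> t c) = 0" using assms
    by (simp add: ac_simps B_sym[of a b] B_sym[of a "b \<cdot> c"] B_sym[of b "a \<cdot> c"])
  then show ?thesis by (rule sum_zeroD_field)
qed

text \<open>By \<open>adjoint_left\<close>, each of the five products in \<open>B_mult\<close> for
  \<open>u\<close>, \<open>v\<close>, \<open>z\<close>, \<open>c\<close> becomes \<open>B c\<close>
  of an element. All terms containing \<open>t z\<close> cancel, and nondegeneracy removes
  \<open>c\<close>.\<close>

lemma left_anticommutator:
  assumes V: "u \<in> V" "v \<in> V" "z \<in> V"
  shows "u \<cdot> (v \<cdot> z) + v \<cdot> (u \<cdot> z)
    = T u *s (v \<cdot> z) + T v *s (u \<cdot> z) + t v \<cdot> (t u \<cdot> z) + B u v *s z"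
proof (rule sum_zeroD, rule eq_zeroI)
  fix c assume c: "c \<in> V"
  have 1: "B (u \<cdot> z) (v \<cdot> c) = B c (T v *s (u \<cdot> z) + v \<cdot> (u \<cdot> z) + t v \<cdot> (t u \<cdot> z + u \<cdot> t z))"
    using adjoint_left[of v c "u \<cdot> z"] V c B_sym[of "u \<cdot> z"] by simp
  have 2: "B (u \<cdot> t z) (t v \<cdot> c) = B c (t v \<cdot> (u \<cdot> t z))"
    using adjoint_left[of "t v" c "u \<cdot> t z"] V c B_sym[of "u \<cdot> t z"] by simp
  have 3: "B (u \<cdot> c) (v \<cdot> z) = B c (T u *s (v \<cdot> z) + u \<cdot> (v \<cdot> z) + t u \<cdot> (t v \<cdot> z + v \<cdot> t z))"
    using adjoint_left[of u c "v \<cdot> z"] V c by simp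
  have 4: "B (u \<cdot> t c) (t v \<cdot> z) = B c (T u *s (t v \<cdot> t z) + t u \<cdot> (t v \<cdot> z) + u \<cdot> (t v \<cdot> t z))"
    using adjoint_left[of u "t c" "t v \<cdot> z"] V c by (simp add: B_t)
  have 5: "B (u \<cdot> t c) (v \<cdot> t z) = B c (T u *s (t v \<cdot> t z) + t u \<cdot> (v \<cdot> t z) + u \<cdot> (t v \<cdot> t z))"
    using adjoint_left[of u "t c" "v \<cdot> t z"] V c by (simp add: B_t)
  have "B u v * B z c + (B (u \<cdot> z) (v \<cdot> c) + B (u \<cdot> t z) (t v \<cdot> c) + B (u \<cdot> c) (v \<cdot> z)
      + B (u \<cdot> t c) (t v \<cdot> z) + B (u \<cdot> t c) (v \<cdot> t z)) = 0"
    using B_mult[of u v z c] V c by simp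
  then show "B c (u \<cdot> (v \<cdot> z) + v \<cdot> (u \<cdot> z) +
      (T u *s (v \<cdot> z) + T v *s (u \<cdot> z) + t v \<cdot> (t u \<cdot> z) + B u v *s z)) = 0"
    unfolding 1 2 3 4 5 using V c B_sym[of z c] by (simp add: ac_simps)
qed (use V in simp)

text \<open>For \<open>w\<close> in the kernel of \<open>t\<close> the surviving twist terms, both
  equal to \<open>(t z \<cdot> w) \<cdot> t v\<close>, cancel, which leaves the untwisted Clifford
  relation.\<close>

lemma right_anticommutator:
  assumes V: "v \<in> V" "w \<in> V" "z \<in> V" and w: "t w = 0"
  shows "(z \<cdot> w) \<cdot> v + (z \<cdot> v) \<cdot> w = T v *s (z \<cdot> w) + T w *s (z \<cdot> v) + B v w *s z"
proof (rule sum_zeroD, rule eq_zeroI)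
  fix c assume c: "c \<in> V"
  have 1: "B (c \<cdot> v) (z \<cdot> w) = B c (T v *s (z \<cdot> w) + (z \<cdot> w) \<cdot> v + (t z \<cdot> w) \<cdot> t v)"
    using adjoint_right[of c "z \<cdot> w" v] V(1-3) c w by simp
  have 2: "B (c \<cdot> w) (z \<cdot> v) = B c (T w *s (z \<cdot> v) + (z \<cdot> v) \<cdot> w)"
    using adjoint_right[of c "z \<cdot> v" w] V(1-3) c w by simp
  have 3: "B (c \<cdot> t v) (t z \<cdot> w) = B c ((t z \<cdot> w) \<cdot> t v)"
    using adjoint_right[of c "t z \<cdot> w" "t v"] V(1-3) c w by simp
  have "B v w * B c z + (B (c \<cdot> v) (z \<cdot> w) + B (c \<cdot> w) (z \<cdot> v) + B (c \<cdot> t v) (t z \<cdot> w)) = 0"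
    using B_mult[of c z v w] V(1-3) c w by (simp add: ac_simps)
  then show "B c ((z \<cdot> w) \<cdot> v + (z \<cdot> v) \<cdot> w +
      (T v *s (z \<cdot> w) + T w *s (z \<cdot> v) + B v w *s z)) = 0"
    unfolding 1 2 3 using V(1-3) c by (simp add: ac_simps)
qed (use V in simp)

text \<open>In characteristic 2 the anticommutator relation at equal arguments says nothing about
  squares. They come from multiplicativity on \<open>u \<otimes> u\<close> instead, combined with
  the adjoint.\<close>

lemma left_square:
  assumes V: "u \<in> V" "w \<in> V" and u: "t u = 0"
  shows "u \<cdot> (u \<cdot> w) = T u *s (u \<cdot> w) + q u *s w"
proof (rule sum_zeroD, rule eq_zeroI)
  fix c assume "c \<in> V"
  then show "B c (u \<cdot> (u \<cdot> w) + (T u *s (u \<cdot> w) + q u *s w)) = 0"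
    using adjoint_left[of u c "u \<cdot> w"] B_mult_left[of u c w] V(1,2) u by (simp add: ac_simps)
qed (use V in simp)

lemma right_square:
  assumes V: "u \<in> V" "w \<in> V" and u: "t u = 0"
  shows "(w \<cdot> u) \<cdot> u = T u *s (w \<cdot> u) + q u *s w"
proof (rule sum_zeroD, rule eq_zeroI)
  fix c assume "c \<in> V"
  then show "B c ((w \<cdot> u) \<cdot> u + (T u *s (w \<cdot> u) + q u *s w)) = 0"
    using adjoint_right[of c "w \<cdot> u" u] B_mult_right[of u c w] V(1,2) u by (simp add: ac_simps)
qed (use V in simp)

text \<open>On the image of \<open>t\<close> the traces, the twist term and \<open>B\<close> all
  vanish, so the Clifford relation reduces to commutation.\<close>

lemma image_left_commute:
  assumes "u \<in> V" "v \<in> V" "w \<in> V"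
  shows "t u \<cdot> (t v \<cdot> w) = t v \<cdot> (t u \<cdot> w)"
  using left_anticommutator[of "t u" "t v" w] assms by (simp add: sum_zeroD)

lemma image_commute:
  assumes "u \<in> V" "v \<in> V"
  shows "t u \<cdot> t v = t v \<cdot> t u"
  using image_left_commute[of u v e] assms by simp

text \<open>The square of left multiplication by \<open>t u\<close> is the scalar
  \<open>q (t u)\<close>. Since \<open>t u \<cdot> t u = t (u \<cdot> t u)\<close>, a nonzero scalar
  would put \<open>e\<close> into the image of \<open>t\<close>.\<close>

lemma image_left_square:
  assumes "u \<in> V" "w \<in> V"
  shows "t u \<cdot> (t u \<cdot> w) = 0"
proof -
  have "t (u \<cdot> t u) = q (t u) *s e"
    using left_square[of "t u" e] assms by simp
  moreover have "t ((1 / q (t u)) *s (u \<cdot> t u)) \<noteq> e"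
    using assms by (intro unit_notin_image) simp
  ultimately have "q (t u) = 0" using assms by (auto simp del: t_mult split: if_splits)
  then show ?thesis using left_square[of "t u" w] assms by simp
qed

text \<open>The annihilator of \<open>t h \<cdot> t z\<close> in the image of \<open>t\<close> contains that of \<open>t z\<close> and also \<open>t h\<close>,
  so a \<open>t z\<close> with an annihilator of maximal dimension is annihilated by the whole image.\<close>

lemma ex_annihilated_by_image:
  assumes "x \<in> V" "t x \<noteq> 0"
  obtains z where "z \<in> V" "t z \<noteq> 0" "\<And>h. h \<in> V \<Longrightarrow> t h \<cdot> t z = 0"
proof -
  \<comment> \<open>The number of independent annihilating elements replaces the dimension of the
    annihilator; finite dimension bounds it, so a maximum exists.\<close>
  define P where "P n \<longleftrightarrow> (\<exists>z A. z \<in> V \<and> t z \<noteq> 0 \<and> A \<subseteq> t ` V \<and> independent A \<and> finite A \<and>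
    (\<forall>a\<in>A. a \<cdot> t z = 0) \<and> card A = n)" for n
  obtain S where S: "finite S" "V \<subseteq> span S" using finite_dim by blast
  have "n \<le> card S" if "P n" for n
    using that S independent_span_bound[of S] unfolding P_def by fastforce
  moreover have "P 0" unfolding P_def using assms by (auto intro!: exI[of _ x] exI[of _ "{}"] simp: independent_empty)
  ultimately obtain n where n: "P n" "\<not> P (Suc n)"
    by (metis nat_induct not_less_eq_eq)
  then obtain z A where A: "z \<in> V" "t z \<noteq> 0" "A \<subseteq> t ` V" "independent A" "finite A"
    "\<forall>a\<in>A. a \<cdot> t z = 0" "card A = n" unfolding P_def by blast
  have "t h \<cdot> t z = 0" if h: "h \<in> V" for h
  proof (rule ccontr)
    assume ne: "t h \<cdot> t z \<noteq> 0"
    have "subspace {a \<in> V. a \<cdot> t z = 0}"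
      using A(1) by (intro subspaceI) auto
    then have "span A \<subseteq> {a \<in> V. a \<cdot> t z = 0}"
      using A(3,6) by (intro span_minimal) auto
    then have "t h \<notin> span A" using ne by auto
    then have "t h \<notin> A" "independent (insert (t h) A)"
      using A(4) span_base by (auto simp: independent_insert)
    moreover from this have "card (insert (t h) A) = Suc n" using A(5,7) by simp
    moreover have "a \<cdot> (t h \<cdot> t z) = 0" if a: "a \<in> A" for a
    proof -
      obtain g where "g \<in> V" "a = t g" using A(3) a by blast
      then show ?thesis using image_left_commute[of g h "t z"] A(1,6) h a by simp
    qed
    moreover have "t h \<cdot> (t h \<cdot> t z) = 0" using image_left_square h A(1) by simp
    \<comment> \<open>The product is again in the image of \<open>t\<close>, so
      \<open>t h \<cdot> z\<close> competes with \<open>z\<close>.\<close>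
    moreover have "t (t h \<cdot> z) = t h \<cdot> t z" using h A(1) by simp
    ultimately have "P (Suc n)" unfolding P_def using ne h A
      by (intro exI[of _ "t h \<cdot> z"] exI[of _ "insert (t h) A"]) auto
    then show False using n by blast
  qed
  with A show thesis using that by blast
qed

section \<open>Peirce decomposition for an idempotent in the kernel of \<open>t\<close>\<close>

theorem action_trivial:
  assumes "u \<in> V"
  shows "t u = 0"
proof (rule ccontr)
  assume "t u \<noteq> 0"
  then obtain z\<^sub>0 where z0: "z\<^sub>0 \<in> V" "t z\<^sub>0 \<noteq> 0" "\<And>h. h \<in> V \<Longrightarrow> t h \<cdot> t z\<^sub>0 = 0"
    using ex_annihilated_by_image assms by blast
  define r where "r = t z\<^sub>0"
  have r [simp]: "r \<in> V" "r \<noteq> 0" "t r = 0" "T r = 0" using z0 by (auto simp: r_def)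
  obtain b where b [simp]: "b \<in> V" "B b r = 1" using ex_B_eq_1 r(1,2) by blast
  define p where "p = r \<cdot> b"
  have p [simp]: "p \<in> V" by (simp add: p_def)
  \<comment> \<open>\<open>t p\<close> is \<open>r \<cdot> t b\<close>, which commutes to
    \<open>t b \<cdot> r = 0\<close>.\<close>
  have tp [simp]: "t p = 0"
    using z0 image_commute[of z\<^sub>0 b] by (simp add: p_def r_def)
  have Tp [simp]: "T p = 1"
    using adjoint_left[of r b e] by (simp add: p_def)
  then have p_ne [simp]: "p \<noteq> 0" by (metis B_0_left e_closed zero_neq_one)
  have rp [simp]: "r \<cdot> p = 0"
    using image_left_square z0(1) by (simp add: p_def r_def)
  have Bpr [simp]: "B p r = 0" using z0(1) B_t[of p z\<^sub>0] by (simp add: r_def)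
  \<comment> \<open>Since \<open>r \<cdot> p = 0\<close> while \<open>B r b = 1\<close>,
    multiplicativity forces \<open>q p = 0\<close>; with \<open>T p = 1\<close> the square relations
    then make \<open>p\<close> idempotent.\<close>
  have qp [simp]: "q p = 0"
    using B_mult_right[of p r b] B_sym[of r b] by simp
  have pp [simp]: "p \<cdot> (p \<cdot> v) = p \<cdot> v" "(v \<cdot> p) \<cdot> p = v \<cdot> p" if "v \<in> V" for v
    using left_square[of p v] right_square[of p v] that by simp_all
  have p_p [simp]: "p \<cdot> p = p" using pp(1)[of e] by simp
  have pc: "p \<cdot> v + v \<cdot> p = T v *s p + v + B v p *s e" if "v \<in> V" for v
    using left_anticommutator[of v p e] that by (simp add: ac_simps)
  have pr [simp]: "p \<cdot> r = r" using pc[of r] B_sym[of r p] by simp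
  \<comment> \<open>Multiply \<open>pc\<close> by \<open>p\<close> from either side.\<close>
  have pvp: "p \<cdot> (v \<cdot> p) = (T v + B v p) *s p" "(p \<cdot> v) \<cdot> p = (T v + B v p) *s p" if v: "v \<in> V" for v
  proof -
    have "p \<cdot> v + p \<cdot> (v \<cdot> p) = p \<cdot> (p \<cdot> v + v \<cdot> p)" using v by simp
    also have "\<dots> = p \<cdot> v + (T v + B v p) *s p" using v by (simp add: pc scale_left_distrib ac_simps)
    finally show "p \<cdot> (v \<cdot> p) = (T v + B v p) *s p" by simp
    have "v \<cdot> p + (p \<cdot> v) \<cdot> p = (p \<cdot> v + v \<cdot> p) \<cdot> p" using v by (simp add: ac_simps)
    also have "\<dots> = v \<cdot> p + (T v + B v p) *s p" using v by (simp add: pc scale_left_distrib ac_simps)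
    finally show "(p \<cdot> v) \<cdot> p = (T v + B v p) *s p" by simp
  qed
  \<comment> \<open>The adjoint of multiplication by \<open>p\<close> is multiplication by the
    complementary idempotent \<open>e + p\<close>.\<close>
  have B_p_left: "B (p \<cdot> v) v' = B v (v' + p \<cdot> v')" if "v \<in> V" "v' \<in> V" for v v'
    using adjoint_left[of p v v'] that by simp
  have B_p_right: "B (v \<cdot> p) v' = B v (v' + v' \<cdot> p)" if "v \<in> V" "v' \<in> V" for v v'
    using adjoint_right[of v v' p] that by simp

  have t_p: "t (p \<cdot> v) = p \<cdot> t v" "t (v \<cdot> p) = t v \<cdot> p" if "v \<in> V" for v
    using that by simp_all

  \<comment> \<open>\<open>M\<close> and \<open>W\<close> are the off-diagonal Peirce components of
    \<open>p\<close>. As in the split octonions, \<open>M\<close> is isotropic and its product is a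
    kind of cross product into \<open>W\<close>.\<close>
  define M where "M = {v \<in> V. p \<cdot> v = v \<and> v \<cdot> p = 0}"
  define W where "W = {v \<in> V. p \<cdot> v = 0 \<and> v \<cdot> p = v}"
  have MI: "v \<in> M" if "v \<in> V" "p \<cdot> v = v" "v \<cdot> p = 0" for v
    using that by (simp add: M_def)
  have WI: "v \<in> W" if "v \<in> V" "p \<cdot> v = 0" "v \<cdot> p = v" for v
    using that by (simp add: W_def)
  have M [simp]: "v \<in> V" "p \<cdot> v = v" "v \<cdot> p = 0" "B v p = 0" "T v = 0" if "v \<in> M" for v
  proof -
    show v [simp]: "v \<in> V" "p \<cdot> v = v" "v \<cdot> p = 0" using that by (auto simp: M_def)
    show "B v p = 0" using B_p_left[of v p] by simp
    then have "T v *s p = 0" using pc[of v] by simp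
    then show "T v = 0" by simp
  qed
  have W [simp]: "v \<in> V" "p \<cdot> v = 0" "v \<cdot> p = v" "B v p = 0" "T v = 0" if "v \<in> W" for v
  proof -
    show v [simp]: "v \<in> V" "p \<cdot> v = 0" "v \<cdot> p = v" using that by (auto simp: W_def)
    show "B v p = 0" using B_p_right[of v p] by simp
    then have "T v *s p = 0" using pc[of v] by simp
    then show "T v = 0" by simp
  qed
  have tM [simp]: "t v \<in> M" if "v \<in> M" for v
    using that by (intro MI) (simp_all flip: t_p del: t_mult)
  have tW [simp]: "t v \<in> W" if "v \<in> W" for v
    using that by (intro WI) (simp_all flip: t_p del: t_mult)
  have MM: "x \<cdot> z \<in> W" if [simp]: "x \<in> M" "z \<in> M" for x z
  proof -
    have "p \<cdot> (x \<cdot> z) = 0" using left_anticommutator[of x p z] by simp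
    moreover have "(x \<cdot> z) \<cdot> p = x \<cdot> z" using right_anticommutator[of z p x] by simp
    ultimately show ?thesis by (intro WI) simp_all
  qed
  have B_MM: "B x z = 0" if "x \<in> M" "z \<in> M" for x z
    using B_p_left[of x z] that by simp
  \<comment> \<open>Such a product is killed by \<open>p\<close> on both sides; \<open>pc\<close>
    and \<open>pvp\<close> then make it a multiple of \<open>e + p\<close>, and its trace gives the
    coefficient.\<close>
  have WM: "y \<cdot> z = B z y *s (e + p)" if [simp]: "y \<in> W" "z \<in> M" for y z
  proof -
    define X where "X = y \<cdot> z"
    have X [simp]: "X \<in> V" by (simp add: X_def)
    have "p \<cdot> X = 0" using left_anticommutator[of y p z] by (simp add: X_def)
    moreover have "X \<cdot> p = 0" using right_anticommutator[of z p y] by (simp add: X_def)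
    ultimately have "T X *s p + X + B X p *s e = 0" "T X + B X p = 0"
      using pc[of X] pvp(1)[of X] by simp_all
    moreover have "T X = B z y" using adjoint_left[of y z e] by (simp add: X_def)
    ultimately have "B z y *s p + X + B z y *s e = 0" using sum_zeroD_field by metis
    then have "X + B z y *s (e + p) = 0" by (simp add: scale_right_distrib ac_simps)
    then show ?thesis using sum_zeroD unfolding X_def by blast
  qed
  \<comment> \<open>The expansion of a double cross product, with the extra twist term
    \<open>B z (t y) *s t x\<close>.\<close>
  have key: "y \<cdot> (x \<cdot> z) = B z y *s x + B z (t y) *s t x + B x y *s z"
    if [simp]: "y \<in> W" "x \<in> M" "z \<in> M" for x y z
  proof -
    have "y \<cdot> (x \<cdot> z) + x \<cdot> (y \<cdot> z) = t x \<cdot> (t y \<cdot> z) + B x y *s z"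
      using left_anticommutator[of y x z] B_sym[of y x] by simp
    moreover have "x \<cdot> (y \<cdot> z) = B z y *s x" by (simp add: WM)
    moreover have "t x \<cdot> (t y \<cdot> z) = B z (t y) *s t x" by (simp add: WM)
    ultimately have "y \<cdot> (x \<cdot> z) + B z y *s x = B z (t y) *s t x + B x y *s z"
      by simp
    moreover have "y \<cdot> (x \<cdot> z) = B z y *s x + (y \<cdot> (x \<cdot> z) + B z y *s x)"
      by (simp add: add.commute[of "y \<cdot> (x \<cdot> z)"])
    ultimately show ?thesis by (simp only: add.assoc)
  qed
  \<comment> \<open>This is \<open>(p \<cdot> v) \<cdot> (e + p)\<close>, the projection of
    \<open>v\<close> to \<open>M\<close>.\<close>
  have M_proj: "p \<cdot> v + (p \<cdot> v) \<cdot> p \<in> M" if "v \<in> V" for v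
    using that by (intro MI) (simp_all add: pvp)

  \<comment> \<open>The projection of \<open>b\<close> to \<open>W\<close>, which keeps the pairing
    with \<open>r\<close> equal to 1.\<close>
  define y where "y = b \<cdot> p + p \<cdot> (b \<cdot> p)"
  have y [simp]: "y \<in> W" unfolding y_def by (rule WI) (simp_all add: pvp)
  have Bry [simp]: "B r y = 1"
    using B_p_right[of b r] B_sym[of r "b \<cdot> p"] B_sym[of r p] by (simp add: y_def pvp)
  \<comment> \<open>The projection of \<open>z\<^sub>0\<close> to \<open>M\<close>;
    \<open>p \<cdot> r = r\<close> and \<open>r \<cdot> p = 0\<close> preserve
    \<open>t x = r\<close>.\<close>
  define x where "x = p \<cdot> z\<^sub>0 + (p \<cdot> z\<^sub>0) \<cdot> p"
  have x [simp]: "x \<in> M" unfolding x_def using z0(1) by (rule M_proj)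
  have tx [simp]: "t x = r" using z0(1) by (simp add: x_def flip: r_def)
  then have rM [simp]: "r \<in> M" using tM x by metis
  define w where "w = x \<cdot> x"
  have w [simp]: "w \<in> W" by (simp add: w_def MM)
  have Bxty: "B x (t y) = 1" using B_t[of x y] by simp
  \<comment> \<open>The two copies of \<open>B x y *s x\<close> cancel, so only the twist term of
    \<open>key\<close> is left: \<open>x \<cdot> x\<close> is nonzero because of
    \<open>t\<close>.\<close>
  have yw: "y \<cdot> w = r" using key[of y x x] Bxty by (simp add: w_def ac_simps)
  then have "w \<noteq> 0" by auto
  then obtain g where g [simp]: "g \<in> V" "B g w = 1" using ex_B_eq_1 W(1) w by metis
  \<comment> \<open>\<open>t w\<close> is the anticommutator of \<open>x\<close> and
    \<open>r\<close>, which vanishes since \<open>M\<close> is isotropic and traceless.\<close>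
  have tw [simp]: "t w = 0"
    using left_anticommutator[of x r e] B_MM[of x r] by (simp add: w_def ac_simps)
  define k where "k = x \<cdot> r"
  have k [simp]: "k \<in> W" by (simp add: k_def MM)
  have "r \<cdot> r = 0" using image_left_square[of z\<^sub>0 e] z0(1) by (simp add: r_def)
  then have "t k = 0" by (simp add: k_def)
  \<comment> \<open>Here the twist term of \<open>key\<close> is zero as well, because
    \<open>t k = 0\<close>.\<close>
  then have kw: "k \<cdot> w = 0" using key[of k x x] by (simp add: w_def)
  define x' where "x' = p \<cdot> g + (p \<cdot> g) \<cdot> p"
  have x' [simp]: "x' \<in> M" unfolding x'_def by (rule M_proj) simp
  have "B x' w = 1"
    using B_p_left[of g w] B_sym[of p w] by (simp add: x'_def pvp)
  \<comment> \<open>As \<open>B x' w = 1\<close>, the Clifford relation recovers \<open>k\<close>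
    from \<open>k \<cdot> x'\<close>. The latter is a multiple of \<open>e + p\<close>, which fixes
    \<open>w\<close> under left multiplication.\<close>
  then have "(k \<cdot> x') \<cdot> w = k"
    using right_anticommutator[of x' w k] kw by simp
  then have k_eq: "k = B x' k *s w"
    using WM[of k x'] by simp
  have "y \<cdot> k = B x' k *s r"
    by (subst k_eq) (simp add: yw)
  moreover have "y \<cdot> k = x + B x y *s r"
    using key[of y x r] z0(1) by (simp add: k_def) (simp add: r_def)
  \<comment> \<open>Applying \<open>t\<close> kills the multiples of \<open>r\<close> and sends
    \<open>x\<close> to \<open>r\<close>.\<close>
  ultimately have "t (B x' k *s r) = t (x + B x y *s r)" by simp
  then show False by simp
qed

end

section \<open>Tensors and the Frobenius twist\<close>

lemma vector_space_double:
  assumes "vector_space (s :: 'f::field \<Rightarrow> 'a::ab_group_add \<Rightarrow> 'a)" "(2::'f) = 0"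
  shows "x + x = (0::'a)"
proof -
  interpret vector_space s by fact
  have "x + x = s (1 + 1) x" by (simp only: scale_left_distrib scale_one)
  then show ?thesis using assms(2) by simp
qed

lemma linear_map_closed: "linear_map X Y f \<Longrightarrow> u \<in> vcarrier X \<Longrightarrow> f u \<in> vcarrier Y"
  and linear_map_add: "linear_map X Y f \<Longrightarrow> u \<in> vcarrier X \<Longrightarrow> v \<in> vcarrier X \<Longrightarrow> f (u + v) = f u + f v"
  and linear_map_scale: "linear_map X Y f \<Longrightarrow> u \<in> vcarrier X \<Longrightarrow> f (vscale X a u) = vscale Y a (f u)"
  by (auto simp: linear_map_def)

lemma linear_map_0:
  assumes "linear_map X Y f" "0 \<in> vcarrier X"
  shows "f 0 = 0"
  using linear_map_add[OF assms(1,2,2)] by simp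

lemmas tens_add_left = linear_map_add[OF bspec[OF conjunct1[OF bilinear_tens[unfolded bilinear_map_def]]]]
lemmas tens_add_right = linear_map_add[OF bspec[OF conjunct2[OF bilinear_tens[unfolded bilinear_map_def]]]]
lemmas tens_scale_left = linear_map_scale[OF bspec[OF conjunct1[OF bilinear_tens[unfolded bilinear_map_def]]]]
lemmas tens_scale_right = linear_map_scale[OF bspec[OF conjunct2[OF bilinear_tens[unfolded bilinear_map_def]]]]

lemma vscale_tensor_vs [simp]: "vscale (tensor_vs X Y) = tens_scale"
  by (simp add: tensor_vs_def)

lemma vcarrier_tensor [simp]: "vcarrier (tensor X Y) = vcarrier (tensor_vs X Y)"
  and vscale_tensor [simp]: "vscale (tensor X Y) = tens_scale"
  and tact_tensor: "tact (tensor X Y) =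
     lift X Y (tensor_vs X Y) (\<lambda>u v. tens X Y (tact X u) v + tens X Y u (tact Y v))"
  by (simp_all add: tensor_def tensor_vs_def vs.extend_def ver4.fields_def)

lemma unit_object_simps [simp]:
  "vcarrier unit_object = UNIV" "vscale unit_object = (*)" "tact unit_object = (\<lambda>_. 0)"
  by (simp_all add: unit_object_def ground_vs_def vs.extend_def ver4.fields_def)

lemma gamma2_simps [simp]:
  "vscale (gamma2 U) = tens_scale" "tact (gamma2 U) = tact (tensor U U)"
  by (simp_all add: gamma2_def tensor_def tensor_vs_def vs.extend_def ver4.fields_def)

lemma vspace_tensor:
  fixes X :: "('f::field, 'a::ab_group_add) ver4" and Y :: "('f, 'b::ab_group_add) ver4"
  shows "vspace (tensor X Y)"
proof -
  interpret T: vector_space "tens_scale :: 'f \<Rightarrow> ('f, 'a, 'b) tens \<Rightarrow> _"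
    by (rule vector_space_tens_scale)
  show ?thesis by (simp add: vspace_def vector_space_tens_scale) (simp add: tensor_vs_def)
qed

lemma vspace_unit_object: "vspace (unit_object :: ('f::field, 'f) ver4)"
proof -
  interpret F: vector_space "(*) :: 'f \<Rightarrow> 'f \<Rightarrow> 'f" by unfold_locales (auto simp: algebra_simps)
  show ?thesis by (simp add: vspace_def F.vector_space_axioms)
qed

lemma bilinear_map_tensor [simp]:
  "bilinear_map X Y (tensor X' Y') f = bilinear_map X Y (tensor_vs X' Y') f"
  by (simp add: bilinear_map_def linear_map_def)

locale ver4_char2 =
  fixes U :: "('f::field, 'a::ab_group_add) ver4"
  assumes char2: "(2::'f) = 0" and object: "ver4_object U"
begin

abbreviation V where "V \<equiv> vcarrier U"
abbreviation t where "t \<equiv> tact U"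
abbreviation scale (infixr "*s" 75) where "a *s u \<equiv> vscale U a u"
abbreviation tensor_pure (infixl "\<otimes>" 71) where "u \<otimes> v \<equiv> tens U U u v"
abbreviation V2 where "V2 \<equiv> vcarrier (tensor_vs U U)"
abbreviation \<sigma> where "\<sigma> \<equiv> braiding U U"

sublocale U: vector_space "vscale U"
  using object by (simp add: ver4_object_def vspace_def)

sublocale T: vector_space "tens_scale :: 'f \<Rightarrow> ('f, 'a, 'a) tens \<Rightarrow> _"
  by (rule vector_space_tens_scale)

lemma subspace_V: "U.subspace V"
  using object by (simp add: ver4_object_def vspace_def)

lemma subspace_V2: "T.subspace V2"
  by (simp add: tensor_vs_def)

lemma V_closed [simp]: "0 \<in> V" "u \<in> V \<Longrightarrow> v \<in> V \<Longrightarrow> u + v \<in> V" "u \<in> V \<Longrightarrow> a *s u \<in> V"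
  using subspace_V by (auto simp: U.subspace_0 U.subspace_add U.subspace_scale)

lemma V2_closed [simp]: "0 \<in> V2" "x \<in> V2 \<Longrightarrow> y \<in> V2 \<Longrightarrow> x + y \<in> V2" "x \<in> V2 \<Longrightarrow> tens_scale a x \<in> V2"
  using subspace_V2 by (auto simp: T.subspace_0 T.subspace_add T.subspace_scale)

lemma double [simp]: "(u::'a) + u = 0" "(u::'a) + (u + v) = v"
  using vector_space_double[OF U.vector_space_axioms char2] by (simp_all flip: add.assoc)

lemma double_tens [simp]: "(x::('f, 'a, 'a) tens) + x = 0" "x + (x + y) = y"
  using vector_space_double[OF T.vector_space_axioms char2] by (simp_all flip: add.assoc)

lemma double_field: "(a::'f) + a = 0"
  using mult_2[of a] char2 by simp

lemma two_times_tens [simp]: "2 * (x::('f, 'a, 'a) tens) = 0"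
  by (simp add: mult_2)

lemma minus_tens: "(x::('f, 'a, 'a) tens) - y = x + y"
  by (simp add: diff_eq_eq add.assoc)

lemma minus_field: "(a::'f) - b = a + b"
  by (simp add: diff_eq_eq add.assoc double_field)

lemma t_linear: "linear_map U U t"
  using object by (simp add: ver4_object_def)

lemma t_simps [simp]: "u \<in> V \<Longrightarrow> t u \<in> V" "u \<in> V \<Longrightarrow> v \<in> V \<Longrightarrow> t (u + v) = t u + t v"
  "u \<in> V \<Longrightarrow> t (a *s u) = a *s t u" "u \<in> V \<Longrightarrow> t (t u) = 0" "t 0 = 0"
  using object t_linear linear_map_0[OF t_linear]
  by (simp_all add: ver4_object_def linear_map_closed linear_map_add linear_map_scale)

lemma tens_closed [simp]: "u \<in> V \<Longrightarrow> v \<in> V \<Longrightarrow> u \<otimes> v \<in> V2"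
  by (rule tens_in_tensor)

lemma tens_add [simp]:
  assumes "u \<in> V" "v \<in> V" "w \<in> V"
  shows "(u + v) \<otimes> w = u \<otimes> w + v \<otimes> w" "w \<otimes> (u + v) = w \<otimes> u + w \<otimes> v"
  using tens_add_left[of w U u U v] tens_add_right[of w U u U v] assms by simp_all

lemma tens_smult [simp]:
  assumes "u \<in> V" "v \<in> V"
  shows "(a *s u) \<otimes> v = tens_scale a (u \<otimes> v)" "u \<otimes> (a *s v) = tens_scale a (u \<otimes> v)"
  using tens_scale_left[of v U u U a] tens_scale_right[of u U v U a] assms by simp_all

lemma tens_0 [simp]:
  assumes "u \<in> V"
  shows "0 \<otimes> u = 0" "u \<otimes> 0 = 0"
  using tens_add(1)[of 0 0 u] tens_add(2)[of 0 0 u] assms by simp_all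

lemma bilinearI:
  assumes "\<And>u v. u \<in> V \<Longrightarrow> v \<in> V \<Longrightarrow> f u v \<in> V2"
    and "\<And>u v w. u \<in> V \<Longrightarrow> v \<in> V \<Longrightarrow> w \<in> V \<Longrightarrow> f (u + v) w = f u w + f v w"
    and "\<And>u v w. u \<in> V \<Longrightarrow> v \<in> V \<Longrightarrow> w \<in> V \<Longrightarrow> f w (u + v) = f w u + f w v"
    and "\<And>a u v. u \<in> V \<Longrightarrow> v \<in> V \<Longrightarrow> f (a *s u) v = tens_scale a (f u v)"
    and "\<And>a u v. u \<in> V \<Longrightarrow> v \<in> V \<Longrightarrow> f u (a *s v) = tens_scale a (f u v)"
  shows "bilinear_map U U (tensor_vs U U) f"
  using assms by (auto simp: bilinear_map_def linear_map_def)

text \<open>Linear endomorphisms rather than morphisms of the category: multiplication by a fixed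
  tensor need not commute with \<open>t\<close>.\<close>

definition endo :: "(('f, 'a, 'a) tens \<Rightarrow> ('f, 'a, 'a) tens) \<Rightarrow> bool" where
  "endo f \<longleftrightarrow> linear_map (tensor_vs U U) (tensor_vs U U) f"

lemma endo_simps:
  assumes "endo f"
  shows "x \<in> V2 \<Longrightarrow> f x \<in> V2" "x \<in> V2 \<Longrightarrow> y \<in> V2 \<Longrightarrow> f (x + y) = f x + f y"
    "x \<in> V2 \<Longrightarrow> f (tens_scale a x) = tens_scale a (f x)" "f 0 = 0"
  using assms linear_map_0[of "tensor_vs U U" "tensor_vs U U" f]
  by (simp_all add: endo_def linear_map_def image_subset_iff)

lemma endoI:
  assumes "\<And>x. x \<in> V2 \<Longrightarrow> f x \<in> V2" "\<And>x y. x \<in> V2 \<Longrightarrow> y \<in> V2 \<Longrightarrow> f (x + y) = f x + f y"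
    "\<And>a x. x \<in> V2 \<Longrightarrow> f (tens_scale a x) = tens_scale a (f x)"
  shows "endo f"
  using assms by (auto simp: endo_def linear_map_def)

lemma endo_eqI:
  assumes "endo f" "endo g" "\<And>u v. u \<in> V \<Longrightarrow> v \<in> V \<Longrightarrow> f (u \<otimes> v) = g (u \<otimes> v)" "x \<in> V2"
  shows "f x = g x"
  using lift_unique[of "tensor_vs U U" U U f g x] assms vspace_tensor[of U U]
  by (simp add: endo_def vspace_def)

lemma lift_endo:
  assumes "bilinear_map U U (tensor_vs U U) f"
  shows "endo (lift U U (tensor U U) f)" "u \<in> V \<Longrightarrow> v \<in> V \<Longrightarrow> lift U U (tensor U U) f (u \<otimes> v) = f u v"
  using lift_linear[OF vspace_tensor, of U U U U f] lift_tens[OF vspace_tensor, of U U U U f] assms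
  by (simp_all add: endo_def linear_map_def)

lemma lift_tensor_vs: "lift U U (tensor_vs U U) f = lift U U (tensor U U) f"
  by (simp add: lift_def linear_map_def)

lemma braiding_bilinear: "bilinear_map U U (tensor_vs U U) (\<lambda>u v. v \<otimes> u + t v \<otimes> t u)"
  by (rule bilinearI) (simp_all add: T.scale_right_distrib ac_simps)

lemma endo_braiding: "endo \<sigma>"
  and braiding_tens [simp]: "u \<in> V \<Longrightarrow> v \<in> V \<Longrightarrow> \<sigma> (u \<otimes> v) = v \<otimes> u + t v \<otimes> t u"
  using lift_endo[OF braiding_bilinear] by (simp_all add: braiding_def)

lemmas braiding_simps [simp] = endo_simps[OF endo_braiding]

text \<open>On a pure tensor the two copies of \<open>t u \<otimes> t v\<close> cancel, and
  \<open>t\<close> squares to zero.\<close>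

lemma braiding_braiding [simp]:
  assumes "x \<in> V2" shows "\<sigma> (\<sigma> x) = x"
proof (rule endo_eqI[of "\<lambda>x. \<sigma> (\<sigma> x)" "\<lambda>x. x"])
  show "endo (\<lambda>x. \<sigma> (\<sigma> x))" "endo (\<lambda>x. x)" by (rule endoI; simp)+
qed (use assms in simp_all)

lemma endo_t: "endo (tact (tensor U U))"
  and t_tens: "u \<in> V \<Longrightarrow> v \<in> V \<Longrightarrow> tact (tensor U U) (u \<otimes> v) = t u \<otimes> v + u \<otimes> t v"
proof -
  have "bilinear_map U U (tensor_vs U U) (\<lambda>u v. t u \<otimes> v + u \<otimes> t v)"
    by (rule bilinearI) (simp_all add: T.scale_right_distrib ac_simps)
  note l = lift_endo[OF this, folded lift_tensor_vs]
  show "endo (tact (tensor U U))" using l(1) by (simp add: tact_tensor)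
  show "u \<in> V \<Longrightarrow> v \<in> V \<Longrightarrow> tact (tensor U U) (u \<otimes> v) = t u \<otimes> v + u \<otimes> t v"
    using l(2) by (simp add: tact_tensor)
qed

section \<open>Symmetric tensors and the vanishing of the Frobenius twist\<close>

abbreviation \<Gamma> where "\<Gamma> \<equiv> vcarrier (gamma2 U)"

lemma Gamma_iff: "x \<in> \<Gamma> \<longleftrightarrow> x \<in> V2 \<and> \<sigma> x = x"
  by (simp add: gamma2_def) metis

lemma Gamma_closed [simp]: "x \<in> \<Gamma> \<Longrightarrow> y \<in> \<Gamma> \<Longrightarrow> x + y \<in> \<Gamma>" "x \<in> \<Gamma> \<Longrightarrow> tens_scale a x \<in> \<Gamma>" "0 \<in> \<Gamma>"
  unfolding Gamma_iff by simp_all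

text \<open>This is \<open>(id + \<sigma>)(u \<otimes> v)\<close>, so it lies in
  \<open>\<Gamma>\<close> because \<open>\<sigma>\<close> is an involution.\<close>

definition sym :: "'a \<Rightarrow> 'a \<Rightarrow> ('f, 'a, 'a) tens" where
  "sym u v = u \<otimes> v + v \<otimes> u + t v \<otimes> t u"

lemma sym_Gamma [simp]: "u \<in> V \<Longrightarrow> v \<in> V \<Longrightarrow> sym u v \<in> \<Gamma>"
  unfolding Gamma_iff sym_def by (simp add: ac_simps)

lemma diag_Gamma [simp]: "u \<in> V \<Longrightarrow> t u = 0 \<Longrightarrow> u \<otimes> u \<in> \<Gamma>"
  unfolding Gamma_iff by simp

lemma Gamma_V2 [simp]: "x \<in> \<Gamma> \<Longrightarrow> x \<in> V2"
  by (simp add: Gamma_iff)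

text \<open>Multiplication by \<open>h \<otimes> h\<close> writes each \<open>x\<close> in
  \<open>\<Gamma>\<close> as \<open>g x - \<sigma> (g x)\<close>, so \<open>\<Gamma>\<close> maps to
  zero in the symmetric square.\<close>

lemma frobenius_twist_trivial:
  assumes h: "h \<in> V" and m: "linear_map (tensor_vs U U) U \<mu>"
    and t_m: "\<And>u v. u \<in> V \<Longrightarrow> v \<in> V \<Longrightarrow> t (\<mu> (u \<otimes> v)) = \<mu> (t u \<otimes> v) + \<mu> (u \<otimes> t v)"
    and unit: "\<And>u. u \<in> V \<Longrightarrow> \<mu> (t h \<otimes> u) = u"
  shows "frobenius_twist U = {sym2_proj U 0}"
proof -
  have m_closed [simp]: "x \<in> V2 \<Longrightarrow> \<mu> x \<in> V" for x
    using m by (auto simp: linear_map_def)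
  have m_lin [simp]: "x \<in> V2 \<Longrightarrow> y \<in> V2 \<Longrightarrow> \<mu> (x + y) = \<mu> x + \<mu> y"
    "x \<in> V2 \<Longrightarrow> \<mu> (tens_scale a x) = a *s \<mu> x" for x y a
    using m by (auto simp: linear_map_def)
  have m_0 [simp]: "\<mu> 0 = 0"
    using linear_map_0[OF m] by simp
  \<comment> \<open>\<open>g x = (h \<otimes> h) x\<close>, so \<open>\<sigma> (g x) = (h \<otimes> h + e \<otimes> e) (\<sigma> x)\<close>\<close>
  define g where "g = lift U U (tensor U U) (\<lambda>u v. \<mu> (h \<otimes> u) \<otimes> \<mu> (h \<otimes> v) + \<mu> (h \<otimes> t u) \<otimes> v)"
  have "bilinear_map U U (tensor_vs U U) (\<lambda>u v. \<mu> (h \<otimes> u) \<otimes> \<mu> (h \<otimes> v) + \<mu> (h \<otimes> t u) \<otimes> v)"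
    using h by (intro bilinearI) (simp_all add: T.scale_right_distrib ac_simps)
  from lift_endo[OF this] have g [simp]: "endo g"
    "u \<in> V \<Longrightarrow> v \<in> V \<Longrightarrow> g (u \<otimes> v) = \<mu> (h \<otimes> u) \<otimes> \<mu> (h \<otimes> v) + \<mu> (h \<otimes> t u) \<otimes> v" for u v
    by (simp_all add: g_def)
  note endo_simps[OF g(1), simp]
  have "\<sigma> (g x) = g (\<sigma> x) + \<sigma> x" if x: "x \<in> V2" for x
  proof (rule endo_eqI[where x = x])
    show "endo (\<lambda>x. \<sigma> (g x))" "endo (\<lambda>x. g (\<sigma> x) + \<sigma> x)"
      by (rule endoI; simp add: T.scale_right_distrib ac_simps)+
    show "\<sigma> (g (u \<otimes> v)) = g (\<sigma> (u \<otimes> v)) + \<sigma> (u \<otimes> v)" if "u \<in> V" "v \<in> V" for u v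
      using that h by (simp add: t_m unit ac_simps)
  qed fact
  then have c_g: "\<sigma> (g x) = g x + x" if "x \<in> \<Gamma>" for x
    using that by (simp add: Gamma_iff)
  have "sym2_proj U x = sym2_proj U 0" if x: "x \<in> \<Gamma>" for x
  proof -
    \<comment> \<open>Shifting the representative by \<open>g x\<close> passes between the cosets of
      \<open>x\<close> and \<open>0\<close> in both directions.\<close>
    have eq: "x + (y - \<sigma> y) = 0 + ((y + g x) - \<sigma> (y + g x))"
      "0 + (y - \<sigma> y) = x + ((y + g x) - \<sigma> (y + g x))" if "y \<in> V2" for y
      using x that by (simp_all add: c_g minus_tens ac_simps)
    have closed: "y + g x \<in> V2" if "y \<in> V2" for y using that x by simp
    show ?thesis unfolding sym2_proj_def vcarrier_tensor
    proof (intro equalityI subsetI; clarify)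
      fix y assume y: "y \<in> V2"
      show "\<exists>y'. x + (y - \<sigma> y) = 0 + (y' - \<sigma> y') \<and> y' \<in> V2"
        by (rule exI[of _ "y + g x"]) (rule conjI[OF eq(1)[OF y] closed[OF y]])
      show "\<exists>y'. 0 + (y - \<sigma> y) = x + (y' - \<sigma> y') \<and> y' \<in> V2"
        by (rule exI[of _ "y + g x"]) (rule conjI[OF eq(2)[OF y] closed[OF y]])
    qed
  qed
  then have "frobenius_twist U = (\<lambda>_. sym2_proj U 0) ` \<Gamma>"
    unfolding frobenius_twist_def by (rule image_cong[OF refl])
  then show ?thesis by (simp only: image_constant[OF Gamma_closed(3)])
qed

end

section \<open>From tensors to elements\<close>

locale ver4_composition = ver4_char2 U
  for U :: "('f::field, 'a::ab_group_add) ver4" +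
  fixes \<mu> :: "('f, 'a, 'a) tens \<Rightarrow> 'a"
    and Q :: "('f, 'a, 'a) tens \<Rightarrow> 'f"
    and e :: 'a
  assumes composition: "unital_composition_algebra U \<mu> Q e"
begin

abbreviation m (infixl "\<cdot>" 77) where "u \<cdot> v \<equiv> \<mu> (u \<otimes> v)"

lemma mu_linear: "linear_map (tensor_vs U U) U \<mu>"
  and mu_t: "x \<in> V2 \<Longrightarrow> \<mu> (tact (tensor U U) x) = t (\<mu> x)"
  using composition
  by (simp_all add: unital_composition_algebra_def unital_algebra_def ver4_hom_def linear_map_def)

lemma mu_simps [simp]: "x \<in> V2 \<Longrightarrow> \<mu> x \<in> V" "x \<in> V2 \<Longrightarrow> y \<in> V2 \<Longrightarrow> \<mu> (x + y) = \<mu> x + \<mu> y"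
  "x \<in> V2 \<Longrightarrow> \<mu> (tens_scale a x) = a *s \<mu> x" "\<mu> 0 = 0"
  using mu_linear linear_map_0[OF mu_linear] by (auto simp: linear_map_def)

lemma t_m [simp]: "u \<in> V \<Longrightarrow> v \<in> V \<Longrightarrow> t (u \<cdot> v) = t u \<cdot> v + u \<cdot> t v"
  using mu_t[of "u \<otimes> v"] by (simp add: t_tens)

lemma unit [simp]: "e \<in> V" "u \<in> V \<Longrightarrow> e \<cdot> u = u" "u \<in> V \<Longrightarrow> u \<cdot> e = u" "t e = 0"
proof -
  obtain \<eta> where \<eta>: "ver4_hom unit_object U \<eta>" "\<eta> 1 = e"
    using composition unfolding unital_composition_algebra_def unital_algebra_def by blast
  have "linear_map unit_object U \<eta>" using \<eta>(1) by (simp add: ver4_hom_def)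
  then show "e \<in> V" and "t e = 0"
    using \<eta> linear_map_closed[of unit_object U \<eta> 1] linear_map_0[of unit_object U \<eta>]
    by (auto simp: ver4_hom_def)
  show "u \<in> V \<Longrightarrow> e \<cdot> u = u" "u \<in> V \<Longrightarrow> u \<cdot> e = u"
    using composition by (simp_all add: unital_composition_algebra_def unital_algebra_def)
qed

lemma Q_simps [simp]: "x \<in> \<Gamma> \<Longrightarrow> y \<in> \<Gamma> \<Longrightarrow> Q (x + y) = Q x + Q y"
    "x \<in> \<Gamma> \<Longrightarrow> Q (tens_scale a x) = a * Q x" "Q 0 = 0"
  and Q_t: "x \<in> \<Gamma> \<Longrightarrow> Q (tact (tensor U U) x) = 0"
proof -
  have Q: "ver4_hom (gamma2 U) unit_object Q"
    using composition by (simp add: unital_composition_algebra_def quadratic_form_def)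
  then have "linear_map (gamma2 U) unit_object Q" by (simp add: ver4_hom_def)
  note this [THEN linear_map_add] this [THEN linear_map_scale] this [THEN linear_map_0]
  then show "x \<in> \<Gamma> \<Longrightarrow> y \<in> \<Gamma> \<Longrightarrow> Q (x + y) = Q x + Q y"
    "x \<in> \<Gamma> \<Longrightarrow> Q (tens_scale a x) = a * Q x" "Q 0 = 0"
    by simp_all
  show "x \<in> \<Gamma> \<Longrightarrow> Q (tact (tensor U U) x) = 0"
    using Q by (simp add: ver4_hom_def)
qed

text \<open>The inner \<open>lift\<close> of \<open>tensor_mult\<close>. It must be known to be
  bilinear in \<open>a\<close> and \<open>b\<close> before the outer \<open>lift\<close> can be
  evaluated.\<close>

definition left_mult where
  "left_mult a b = lift U U (tensor U U) (\<lambda>c d. (a \<cdot> c) \<otimes> (b \<cdot> d) + (a \<cdot> t c) \<otimes> (t b \<cdot> d))"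

abbreviation mult (infixl "\<bullet>" 70) where "x \<bullet> y \<equiv> tensor_mult U \<mu> x y"

lemma tensor_mult_eq: "x \<bullet> y = lift U U (tensor U U) (\<lambda>a b. left_mult a b y) x"
  by (simp add: tensor_mult_def left_mult_def)

lemma endo_left_mult: "a \<in> V \<Longrightarrow> b \<in> V \<Longrightarrow> endo (left_mult a b)"
  and left_mult_tens: "a \<in> V \<Longrightarrow> b \<in> V \<Longrightarrow> c \<in> V \<Longrightarrow> d \<in> V \<Longrightarrow>
    left_mult a b (c \<otimes> d) = (a \<cdot> c) \<otimes> (b \<cdot> d) + (a \<cdot> t c) \<otimes> (t b \<cdot> d)"
proof -
  assume ab: "a \<in> V" "b \<in> V"
  have "bilinear_map U U (tensor_vs U U) (\<lambda>c d. (a \<cdot> c) \<otimes> (b \<cdot> d) + (a \<cdot> t c) \<otimes> (t b \<cdot> d))"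
    using ab by (intro bilinearI) (simp_all add: T.scale_right_distrib ac_simps)
  note l = lift_endo[OF this, folded left_mult_def]
  show "endo (left_mult a b)" by (rule l(1))
  show "left_mult a b (c \<otimes> d) = (a \<cdot> c) \<otimes> (b \<cdot> d) + (a \<cdot> t c) \<otimes> (t b \<cdot> d)"
    if "c \<in> V" "d \<in> V" using that by (rule l(2))
qed

lemma left_mult_simps:
  assumes [simp]: "a \<in> V" "a' \<in> V" "b \<in> V" "y \<in> V2"
  shows "left_mult (a + a') b y = left_mult a b y + left_mult a' b y"
    "left_mult b (a + a') y = left_mult b a y + left_mult b a' y"
    "left_mult (k *s a) b y = tens_scale k (left_mult a b y)"
    "left_mult b (k *s a) y = tens_scale k (left_mult b a y)"
proof -
  have E: "endo (left_mult (k *s a) b)" "endo (left_mult b (k *s a))" "endo (left_mult (a + a') b)"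
    "endo (left_mult b (a + a'))" for k
    by (intro endo_left_mult; simp)+
  have S: "endo (\<lambda>y. left_mult b c y + left_mult b' c' y)" "endo (\<lambda>y. tens_scale k (left_mult b c y))"
    if "b \<in> V" "c \<in> V" "b' \<in> V" "c' \<in> V" for b c b' c' k
    using that by (intro endoI; simp add: endo_simps[OF endo_left_mult] T.scale_right_distrib ac_simps)+
  show "left_mult (a + a') b y = left_mult a b y + left_mult a' b y"
    by (rule endo_eqI[OF E(3) S(1)]) (simp_all add: left_mult_tens ac_simps)
  show "left_mult b (a + a') y = left_mult b a y + left_mult b a' y"
    by (rule endo_eqI[OF E(4) S(1)]) (simp_all add: left_mult_tens ac_simps)
  show "left_mult (k *s a) b y = tens_scale k (left_mult a b y)"
    by (rule endo_eqI[OF E(1) S(2)[where b' = a and c' = a]])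
      (simp_all add: left_mult_tens T.scale_right_distrib)
  show "left_mult b (k *s a) y = tens_scale k (left_mult b a y)"
    by (rule endo_eqI[OF E(2) S(2)[where b' = a and c' = a]])
      (simp_all add: left_mult_tens T.scale_right_distrib)
qed

lemma mult_endo: "y \<in> V2 \<Longrightarrow> endo (\<lambda>x. x \<bullet> y)"
  and mult_left_mult: "y \<in> V2 \<Longrightarrow> a \<in> V \<Longrightarrow> b \<in> V \<Longrightarrow> (a \<otimes> b) \<bullet> y = left_mult a b y"
proof -
  assume y [simp]: "y \<in> V2"
  have "bilinear_map U U (tensor_vs U U) (\<lambda>a b. left_mult a b y)"
    by (rule bilinearI) (simp_all add: left_mult_simps endo_simps[OF endo_left_mult])
  note l = lift_endo[OF this]
  show "endo (\<lambda>x. x \<bullet> y)" using l(1) by (simp add: tensor_mult_eq)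
  show "(a \<otimes> b) \<bullet> y = left_mult a b y" if "a \<in> V" "b \<in> V"
    using that by (simp add: tensor_mult_eq l(2))
qed

lemmas mult_simps_left [simp] = endo_simps[OF mult_endo]

lemma mult_tens [simp]: "a \<in> V \<Longrightarrow> b \<in> V \<Longrightarrow> c \<in> V \<Longrightarrow> d \<in> V \<Longrightarrow>
    (a \<otimes> b) \<bullet> (c \<otimes> d) = (a \<cdot> c) \<otimes> (b \<cdot> d) + (a \<cdot> t c) \<otimes> (t b \<cdot> d)"
  by (simp add: mult_left_mult left_mult_tens)

lemma mult_add_right [simp]:
  assumes [simp]: "x \<in> V2" "y \<in> V2" "z \<in> V2"
  shows "x \<bullet> (y + z) = x \<bullet> y + x \<bullet> z"
  by (rule endo_eqI[of "\<lambda>x. x \<bullet> (y + z)" "\<lambda>x. x \<bullet> y + x \<bullet> z", OF mult_endo endoI])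
    (simp_all add: mult_left_mult endo_simps[OF endo_left_mult] T.scale_right_distrib ac_simps)

lemma mult_scale_right [simp]:
  assumes [simp]: "x \<in> V2" "y \<in> V2"
  shows "x \<bullet> tens_scale a y = tens_scale a (x \<bullet> y)"
  by (rule endo_eqI[of "\<lambda>x. x \<bullet> tens_scale a y" "\<lambda>x. tens_scale a (x \<bullet> y)", OF mult_endo endoI])
    (simp_all add: mult_left_mult endo_simps[OF endo_left_mult] T.scale_right_distrib ac_simps)

text \<open>Multiplicativity evaluated at the pure tensor of \<open>x\<close> and \<open>y\<close>,
  once both lifted maps are known to be bilinear.\<close>

lemma Q_mult:
  assumes "x \<in> \<Gamma>" "y \<in> \<Gamma>"
  shows "Q (x \<bullet> y) = Q x * Q y"
proof -
  have "bilinear_map (gamma2 U) (gamma2 U) (tensor U U) (\<bullet>)"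
    by (auto simp: bilinear_map_def linear_map_def)
  from lift_tens[OF vspace_tensor this assms]
  have 1: "gamma2_mult U \<mu> (tens (gamma2 U) (gamma2 U) x y) = x \<bullet> y"
    by (simp add: gamma2_mult_def)
  have "bilinear_map (gamma2 U) (gamma2 U) unit_object (\<lambda>x y. Q x * Q y)"
    by (auto simp: bilinear_map_def linear_map_def algebra_simps)
  from lift_tens[OF vspace_unit_object this assms]
  have 2: "lift (gamma2 U) (gamma2 U) unit_object (\<lambda>x y. Q x * Q y) (tens (gamma2 U) (gamma2 U) x y) = Q x * Q y" .
  have "tens (gamma2 U) (gamma2 U) x y \<in> vcarrier (tensor (gamma2 U) (gamma2 U))"
    using assms by (simp add: tens_in_tensor)
  then show ?thesis
    using composition 1 2 unfolding unital_composition_algebra_def multiplicative_def by metis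
qed

text \<open>Writing the product as a sum of values of \<open>sym\<close> lets \<open>Q\<close> turn
  it into an identity for \<open>B\<close> alone; this is the origin of the five terms of
  \<open>B_mult\<close>.\<close>

lemma sym_mult:
  assumes "u \<in> V" "v \<in> V" "w \<in> V" "z \<in> V"
  shows "sym u v \<bullet> sym w z = sym (u \<cdot> w) (v \<cdot> z) + sym (u \<cdot> t w) (t v \<cdot> z) + sym (u \<cdot> z) (v \<cdot> w)
    + sym (u \<cdot> t z) (t v \<cdot> w) + sym (u \<cdot> t z) (v \<cdot> t w)"
  unfolding sym_def using assms by (simp add: ac_simps)

lemma diag_sym_mult:
  assumes "u \<in> V" "v \<in> V" "w \<in> V" "t u = 0"
  shows "(u \<otimes> u) \<bullet> sym v w = sym (u \<cdot> v) (u \<cdot> w)" "sym v w \<bullet> (u \<otimes> u) = sym (v \<cdot> u) (w \<cdot> u)"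
  unfolding sym_def using assms by (simp_all add: ac_simps)

section \<open>The bilinear form and the transfer to elements\<close>

abbreviation B where "B \<equiv> assoc_bilinear U Q"
abbreviation q where "q u \<equiv> Q (u \<otimes> u)"

lemma B_eq: "B u v = Q (sym u v)"
  by (simp add: assoc_bilinear_def sym_def)

lemma sym_simps:
  assumes "u \<in> V" "v \<in> V" "w \<in> V"
  shows "sym (u + v) w = sym u w + sym v w" "sym w (u + v) = sym w u + sym w v"
    "sym (a *s u) v = tens_scale a (sym u v)" "sym u (a *s v) = tens_scale a (sym u v)"
  unfolding sym_def using assms by (simp_all add: T.scale_right_distrib ac_simps)

lemma B_simps:
  assumes "u \<in> V" "v \<in> V" "w \<in> V"
  shows "B (u + v) w = B u w + B v w" "B w (u + v) = B w u + B w v"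
    "B (a *s u) v = a * B u v" "B u (a *s v) = a * B u v"
  using assms by (simp_all add: B_eq sym_simps)

text \<open>The unit object carries the zero action, so \<open>Q\<close> vanishes on
  \<open>t\<close> applied to \<open>sym u v\<close>.\<close>

lemma B_t:
  assumes [simp]: "u \<in> V" "v \<in> V"
  shows "B (t u) v = B u (t v)"
proof -
  have "tact (tensor U U) (sym u v) = sym (t u) v + sym u (t v)"
    unfolding sym_def by (simp add: endo_simps[OF endo_t] t_tens ac_simps)
  with Q_t[of "sym u v"] have "B (t u) v + B u (t v) = 0" by (simp add: B_eq)
  then show ?thesis by (simp only: eq_iff_diff_eq_0[of "B (t u) v"] minus_field)
qed

text \<open>The defect of symmetry of \<open>sym\<close> is \<open>sym (t u) (t v)\<close>, and
  \<open>Q\<close> sends it to zero after both copies of \<open>t\<close> are moved to one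
  side.\<close>

lemma B_sym:
  assumes [simp]: "u \<in> V" "v \<in> V"
  shows "B u v = B v u"
proof -
  have "sym u v + sym v u = sym (t u) (t v)"
    unfolding sym_def by (simp add: ac_simps)
  then have "B u v + B v u = B (t u) (t v)" by (simp add: B_eq flip: Q_simps)
  also have "\<dots> = B u 0" by (simp add: B_t)
  also have "\<dots> = 0" by (simp add: B_eq sym_def)
  finally show ?thesis by (simp only: eq_iff_diff_eq_0[of "B u v"] minus_field)
qed

lemma composition_data_axioms_hold:
  assumes "frobenius_twist U \<noteq> {sym2_proj U 0}"
  shows "composition_data (vscale U) V (\<cdot>) t B q e"
proof (intro composition_data.intro composition_data_axioms.intro)
  show "vector_space (vscale U)" by unfold_locales
  show "(2::'f) = 0" by (rule char2)
  show "U.subspace V" by (rule subspace_V)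
  show "\<exists>S. finite S \<and> V \<subseteq> U.span S"
    using object by (auto simp: ver4_object_def fin_dim_def)
  show "u = 0" if "u \<in> V" "\<And>v. v \<in> V \<Longrightarrow> B u v = 0" for u
    using that composition by (auto simp: unital_composition_algebra_def nondegenerate_def)
  show "B (u \<cdot> v) (u \<cdot> w) = q u * B v w" "B (v \<cdot> u) (w \<cdot> u) = q u * B v w"
    if "u \<in> V" "v \<in> V" "w \<in> V" "t u = 0" for u v w
    using that by (simp_all add: B_eq mult.commute[of "q u"] flip: Q_mult diag_sym_mult)
      (simp add: mult.commute Q_mult)
  show "B u v * B w z = B (u \<cdot> w) (v \<cdot> z) + B (u \<cdot> t w) (t v \<cdot> z) + B (u \<cdot> z) (v \<cdot> w)
      + B (u \<cdot> t z) (t v \<cdot> w) + B (u \<cdot> t z) (v \<cdot> t w)"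
    if "u \<in> V" "v \<in> V" "w \<in> V" "z \<in> V" for u v w z
    using that Q_mult[of "sym u v" "sym w z"] by (simp add: B_eq sym_mult)
  \<comment> \<open>The assumption on the Frobenius twist enters here.\<close>
  show "t h \<noteq> e" if "h \<in> V" for h
  proof
    assume "t h = e"
    then have "frobenius_twist U = {sym2_proj U 0}"
      by (intro frobenius_twist_trivial[OF that mu_linear]) simp_all
    then show False using assms by simp
  qed
  show "B u v = B v u" "B (t u) v = B u (t v)" if "u \<in> V" "v \<in> V" for u v
    using that by (rule B_sym, rule B_t)
qed (simp_all add: B_simps)

text \<open>With \<open>t = 0\<close> every \<open>u \<otimes> u\<close> lies in
  \<open>\<Gamma>\<close>, so \<open>q\<close> is governed by \<open>Q\<close> everywhere, and its
  polar form is \<open>B\<close>.\<close>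

lemma usual_composition_algebra:
  assumes t_0: "\<And>u. u \<in> V \<Longrightarrow> t u = 0"
  shows "usual_unital_composition_algebra U (\<cdot>) q e"
proof -
  have polar: "q (u + v) - q u - q v = B u v" if [simp]: "u \<in> V" "v \<in> V" for u v
  proof -
    have "(u + v) \<otimes> (u + v) = u \<otimes> u + v \<otimes> v + sym u v"
      by (simp add: sym_def t_0 ac_simps)
    then have "q (u + v) = Q (u \<otimes> u + v \<otimes> v + sym u v)" by (simp only:)
    also have "\<dots> = q u + q v + B u v" by (simp add: B_eq t_0)
    finally have "q (u + v) = q u + q v + B u v" .
    then show ?thesis by simp
  qed
  have "q (u \<cdot> v) = q u * q v" if "u \<in> V" "v \<in> V" for u v
    using Q_mult[of "u \<otimes> u" "v \<otimes> v"] that by (simp add: t_0)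
  moreover have "nondegenerate V (\<lambda>u v. q (u + v) - q u - q v)"
    using composition polar by (auto simp: unital_composition_algebra_def nondegenerate_def)
  moreover have "q (a *s u) = a\<^sup>2 * q u" if "u \<in> V" for a u
    using that by (simp add: t_0 power2_eq_square)
  \<comment> \<open>Expansion of tensors is switched off so that \<open>q (u + v)\<close> stays
    intact until \<open>polar\<close> applies.\<close>
  moreover have "bilinear_map U U ground_vs (\<lambda>u v. q (u + v) - q u - q v)"
    by (auto simp: bilinear_map_def linear_map_def ground_vs_def polar B_simps simp del: tens_add tens_smult)
  moreover have "bilinear_map U U U (\<cdot>)"
    by (auto simp: bilinear_map_def linear_map_def)
  ultimately show ?thesis
    using object by (simp add: usual_unital_composition_algebra_def usual_quadratic_form_def ver4_object_def)
qed

end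

theorem theorem5p16:
  fixes U :: "('f::field, 'a::ab_group_add) ver4"
    and \<mu> :: "('f, 'a, 'a) tens \<Rightarrow> 'a"
    and Q :: "('f, 'a, 'a) tens \<Rightarrow> 'f"
    and e :: 'a
  assumes "CHAR('f) = 2"
    and "unital_composition_algebra U \<mu> Q e"
    and "frobenius_twist U \<noteq> {sym2_proj U 0}"
  shows "(\<forall>u\<in>vcarrier U. tact U u = 0) \<and>
    usual_unital_composition_algebra U (\<lambda>u v. \<mu> (tens U U u v)) (\<lambda>u. Q (tens U U u u)) e"
proof -
  have "(2::'f) = 0" using of_nat_CHAR[where 'a = 'f] assms(1) by simp
  moreover have "ver4_object U"
    using assms(2) by (simp add: unital_composition_algebra_def unital_algebra_def)
  ultimately interpret ver4_composition U \<mu> Q e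
    using assms(2) by unfold_locales
  interpret composition_data "vscale U" "vcarrier U" "\<lambda>u v. \<mu> (tens U U u v)" "tact U"
    "assoc_bilinear U Q" "\<lambda>u. Q (tens U U u u)" e
    using assms(3) by (rule composition_data_axioms_hold)
  have "\<forall>u\<in>vcarrier U. tact U u = 0" using action_trivial by blast
  then show ?thesis using usual_composition_algebra by blast
qed

end
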